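(* Suppose that there exists a state-feedback gain making $A+BK$ stable, and that the MPC optimization problem at the initial time $t_0$ admits a feasible solution $\hat u^*(s;t_0)$. Let the triggering level be $$\delta=\rho\,\overline\lambda(\sqrt P)\left[e^{L\beta T}\left(\frac{\beta T}{L}-\frac1{L^2}\right)+\frac1{L^2}\right],\qquad \beta\in(0,1),$$ and suppose $L\beta T\neq 1$. The MPC problem is iteratively feasible (that is, for every $k\ge 1$, if the MPC problem at $t_{k-1}$ admits a solution, then the MPC problem at the next triggering instant $t_k$ admits a feasible solution) under the following conditions: $$\frac{L^2\beta T e^{L(1-\beta)T}}{L\beta T-1}\,\rho\,\overline\lambda(\sqrt P)\left[e^{L\beta T}\left(\frac{\beta T}{L}-\frac1{L^2}\right)+\frac1{L^2}\right]\le(1-\alpha)\epsilon,$$ $$T\ge\max\left\{-2\frac{\overline\lambda(P)}{\underline\lambda(Q^* )\beta}\ln\alpha,\ \frac1{L\beta}\right\},$$ $$M\ge\max\left\{\frac{L^2\beta T e^{L(1-\beta)T}}{L\beta T-1}\frac{\delta}{\alpha\epsilon}+1,\ 1-\frac1\beta+\frac1{\alpha\beta}\right\}.$$ Moreover, the maximum allowable disturbance can be given as $$\rho\le\frac{(1-\alpha)\epsilon}{\frac{L^2\beta Te^{L(1-\beta)T}}{L\beta T-1}\,\overline\lambda(\sqrt P)\left[e^{L\beta T}\left(\frac{\beta T}{L}-\frac1{L^2}\right)+\frac1{L^2}\right]}.$$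
   Context: Notation: $\|x\|=\sqrt{x^\top x}$; $\|x\|_S=\sqrt{x^\top Sx}$ for a symmetric positive (semi)definite $S$; $\overline\lambda(S),\underline\lambda(S)$ are the largest and smallest eigenvalues of a symmetric matrix $S$; $\sqrt P$ is the symmetric positive definite square root of $P$. System: $\dot x(t)=f(x(t),u(t))+\omega(t)$ with $x(t)\in\mathbb R^n$, $u(t)\in\mathcal U$, where $\mathcal U\subset\mathbb R^m$ is compact and contains the origin, and $\omega(t)\in\mathcal W$ is an unknown disturbance, with $\mathcal W\subset\mathbb R^n$ compact and $\rho=\sup_{\omega(t)\in\mathcal W}\|\omega(t)\|$. The map $f:\mathbb R^n\times\mathbb R^m\to\mathbb R^n$ is twice continuously differentiable, $f(0,0)=0$, and $f$ is Lipschitz in the state with constant $L>0$: $\|f(x,u)-f(y,u)\|_P\le L\|x-y\|_P$ for all $x,y\in\mathbb R^n$, $u\in\mathcal U$. The nominal system is $\dot x=f(x,u)$; $A=\partial f/\partial x|_{(0,0)}$, $B=\partial f/\partial u|_{(0,0)}$. Control signals are piecewise right-continuous. Terminal ingredients: $Q,R$ are positive definite weights; $K$ is a gain with $A+BK$ stable, $Q^*=Q+K^\top RK$, and $P\succ0$ is the unique solution of $(A+BK+\kappa I)^\top P+P(A+BK+\kappa I)=-Q^*$ for a constant $\kappa>0$ smaller than minus the largest real part of the eigenvalues of $A+BK$. Put $V(x)=\|x\|_P^2$ and $\Omega(r)=\{x\in\mathbb R^n:\|x\|_P\le r\}$. The number $\epsilon>0$ is such that $\Omega(\epsilon)$ is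 invariant for the nominal system under $u=Kx$, and for $x(t)\in\Omega(\epsilon)$ one has $Kx(t)\in\mathcal U$ and $\dot V(x(t))\le-\|x(t)\|_{Q^*}^2$ along $\dot x=f(x,Kx)$. (Such $K,\kappa,\epsilon$ are known to exist.) MPC problem at $t_k$, with prediction horizon $T>0$, scaling ratio $\alpha\in(0,1)$ and contraction rate $M$: minimize $$J=\int_{t_k}^{t_k+T}\|\hat x(s;t_k)\|_Q^2+\|\hat u(s;t_k)\|_R^2\,ds+\|\hat x(t_k+T;t_k)\|_P^2$$ over $\hat u(\cdot;t_k)$ on $[t_k,t_k+T]$ subject to $\dot{\hat x}(s;t_k)=f(\hat x(s;t_k),\hat u(s;t_k))$, $\hat x(t_k;t_k)=x(t_k)$, $\hat u(s;t_k)\in\mathcal U$, and the robustness constraint $$\|\hat x(s;t_k)\|_P\le\frac{(t_k+T-s)M+s-t_k}{T}\,\alpha\epsilon,\qquad s\in[t_k,t_k+T]$$ (which at $s=t_k+T$ gives the terminal constraint $\hat x(t_k+T;t_k)\in\Omega(\alpha\epsilon)$). A minimizer is denoted $\hat u^*(\cdot;t_k)$ and its state trajectory $\hat x^*(\cdot;t_k)$. Event triggering, with triggering level $\delta>0$: let $x(s;t_k)$, $s\ge t_k$, be the actual (disturbed) state obtained from $x(t_k)$ when $\hat u^*(\cdot;t_k)$ is applied. Then $$H_k=\inf_{h>0}\Big\{h:\int_{t_k}^{t_k+h}\|x(s;t_k)-\hat x^*(s;t_k)\|_P\,ds=\delta\Big\},\qquad t_{k+1}=\min\{t_k+H_k,\,t_k+T\}$$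 ($\inf\emptyset=+\infty$). The closed loop is $\dot x(t)=f(x(t),\hat u^*(t;t_k))+\omega(t)$ for $t\in[t_k,t_{k+1})$. *)

theory Defs
  imports "HOL-Analysis.Analysis"
begin

definition pos_def :: "real^'n^'n \<Rightarrow> bool" where
  "pos_def S \<longleftrightarrow> transpose S = S \<and> (\<forall>x. x \<noteq> 0 \<longrightarrow> 0 < x \<bullet> (S *v x))"

definition wnorm :: "real^'n^'n \<Rightarrow> real^'n \<Rightarrow> real" where
  "wnorm S x = sqrt (x \<bullet> (S *v x))"

definition sublevel :: "real^'n^'n \<Rightarrow> real \<Rightarrow> (real^'n) set" where
  "sublevel P r = {x. wnorm P x \<le> r}"

definition eigenvalues :: "'a::field^'n^'n \<Rightarrow> 'a set" where
  "eigenvalues A = {l. \<exists>v. v \<noteq> 0 \<and> A *v v = l *s v}"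

definition lambda_max :: "real^'n^'n \<Rightarrow> real" where
  "lambda_max S = Max (eigenvalues S)"

definition lambda_min :: "real^'n^'n \<Rightarrow> real" where
  "lambda_min S = Min (eigenvalues S)"

definition matrix_sqrt :: "real^'n^'n \<Rightarrow> real^'n^'n" where
  "matrix_sqrt P = (THE S. pos_def S \<and> S ** S = P)"

definition spectral_abscissa :: "real^'n^'n \<Rightarrow> real" where
  "spectral_abscissa A = Max (Re ` eigenvalues (map_matrix complex_of_real A))"

definition twice_continuously_differentiable ::
  "('a::real_normed_vector \<Rightarrow> 'b::real_normed_vector) \<Rightarrow> bool" where
  "twice_continuously_differentiable g \<longleftrightarrow>
     (\<exists>(g' :: 'a \<Rightarrow> 'a \<Rightarrow>\<^sub>L 'b) (g'' :: 'a \<Rightarrow> 'a \<Rightarrow>\<^sub>L 'a \<Rightarrow>\<^sub>L 'b).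
        (\<forall>z. (g has_derivative blinfun_apply (g' z)) (at z)) \<and>
        (\<forall>z. (g' has_derivative blinfun_apply (g'' z)) (at z)) \<and>
        continuous_on UNIV g'')"

text \<open>Solutions of \<open>x' = F t x\<close> on \<open>[a, b]\<close> are taken in integrated (Caratheodory) form, since
  controls may jump and disturbances carry no regularity assumption: the equation holds
  almost everywhere, and integrability of the right-hand side is part of being a solution.\<close>

definition solves_ode ::
  "(real \<Rightarrow> 'a::euclidean_space \<Rightarrow> 'a) \<Rightarrow> (real \<Rightarrow> 'a) \<Rightarrow> real \<Rightarrow> real \<Rightarrow> bool" where
  "solves_ode F x a b \<longleftrightarrow> (\<forall>t\<in>{a..b}. ((\<lambda>s. F s (x s)) has_integral (x t - x a)) {a..t})"

definition forward_invariant :: "('a::euclidean_space \<Rightarrow> 'a) \<Rightarrow> 'a set \<Rightarrow> bool" where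
  "forward_invariant g S \<longleftrightarrow>
     (\<forall>x b. solves_ode (\<lambda>s. g) x 0 b \<and> x 0 \<in> S \<longrightarrow> (\<forall>s\<in>{0..b}. x s \<in> S))"

text \<open>Piecewise continuous in the usual sense (finitely many discontinuities, left limits exist)
  and continuous from the right.\<close>

definition piecewise_right_continuous ::
  "real \<Rightarrow> real \<Rightarrow> (real \<Rightarrow> 'a::topological_space) \<Rightarrow> bool" where
  "piecewise_right_continuous a b u \<longleftrightarrow>
     (\<exists>D. finite D \<and> (\<forall>t\<in>{a..b} - D. continuous (at t within {a..b}) u)) \<and>
     (\<forall>t\<in>{a..<b}. continuous (at t within {t..b}) u) \<and>
     (\<forall>t\<in>{a<..b}. \<exists>l. (u \<longlongrightarrow> l) (at t within {a..<t}))"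

text \<open>In the following, \<open>tk\<close> is the sampling instant and \<open>xk\<close> the state measured there;
  \<open>u\<close> and \<open>x\<close> are the predicted control and state on \<open>[tk, tk + T]\<close>.\<close>

definition mpc_feasible ::
  "(real^'n \<Rightarrow> real^'m \<Rightarrow> real^'n) \<Rightarrow> (real^'m) set \<Rightarrow> real^'n^'n \<Rightarrow>
   real \<Rightarrow> real \<Rightarrow> real \<Rightarrow> real \<Rightarrow>
   real \<Rightarrow> real^'n \<Rightarrow> (real \<Rightarrow> real^'m) \<Rightarrow> (real \<Rightarrow> real^'n) \<Rightarrow> bool" where
  "mpc_feasible f U P T \<alpha> \<epsilon> M tk xk u x \<longleftrightarrow>
     piecewise_right_continuous tk (tk + T) u \<and>
     solves_ode (\<lambda>s y. f y (u s)) x tk (tk + T) \<and>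
     x tk = xk \<and>
     (\<forall>s\<in>{tk..tk + T}. u s \<in> U) \<and>
     (\<forall>s\<in>{tk..tk + T}. wnorm P (x s) \<le> ((tk + T - s) * M + s - tk) / T * (\<alpha> * \<epsilon>))"

definition mpc_cost ::
  "real^'n^'n \<Rightarrow> real^'m^'m \<Rightarrow> real^'n^'n \<Rightarrow> real \<Rightarrow>
   real \<Rightarrow> (real \<Rightarrow> real^'m) \<Rightarrow> (real \<Rightarrow> real^'n) \<Rightarrow> real" where
  "mpc_cost Q R P T tk u x =
     integral {tk..tk + T} (\<lambda>s. (wnorm Q (x s))\<^sup>2 + (wnorm R (u s))\<^sup>2)
       + (wnorm P (x (tk + T)))\<^sup>2"

definition mpc_optimal ::
  "(real^'n \<Rightarrow> real^'m \<Rightarrow> real^'n) \<Rightarrow> (real^'m) set \<Rightarrow> real^'n^'n \<Rightarrow> real^'m^'m \<Rightarrow> real^'n^'n \<Rightarrow>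
   real \<Rightarrow> real \<Rightarrow> real \<Rightarrow> real \<Rightarrow>
   real \<Rightarrow> real^'n \<Rightarrow> (real \<Rightarrow> real^'m) \<Rightarrow> (real \<Rightarrow> real^'n) \<Rightarrow> bool" where
  "mpc_optimal f U Q R P T \<alpha> \<epsilon> M tk xk u x \<longleftrightarrow>
     mpc_feasible f U P T \<alpha> \<epsilon> M tk xk u x \<and>
     (\<forall>u' x'. mpc_feasible f U P T \<alpha> \<epsilon> M tk xk u' x' \<longrightarrow>
        mpc_cost Q R P T tk u x \<le> mpc_cost Q R P T tk u' x')"

text \<open>The infimum is taken in the extended reals, so it is \<open>\<infinity>\<close> if the level is never reached.
  The predicted control ends at \<open>tk + T\<close>, so the trajectories \<open>xa\<close> and \<open>xh\<close> are only meaningful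
  up to \<open>tk + T\<close>; values of \<open>h\<close> beyond \<open>T\<close> have no influence on \<open>min (tk + H) (tk + T)\<close>.\<close>

definition trigger_interval ::
  "real^'n^'n \<Rightarrow> real \<Rightarrow> real \<Rightarrow> (real \<Rightarrow> real^'n) \<Rightarrow> (real \<Rightarrow> real^'n) \<Rightarrow> ereal" where
  "trigger_interval P \<delta> tk xa xh =
     Inf (ereal ` {h. 0 < h \<and> integral {tk..tk + h} (\<lambda>s. wnorm P (xa s - xh s)) = \<delta>})"

text \<open>One sampling period of the closed loop, from \<open>tk\<close> to \<open>tk1\<close>, for the closed-loop state \<open>x\<close> and
  the disturbance \<open>w\<close>: \<open>u\<close>, \<open>xh\<close> is a minimizer of the problem at \<open>tk\<close> with its predicted state,
  and \<open>xa\<close> is the disturbed state obtained from \<open>x tk\<close> when \<open>u\<close> is applied in open loop.\<close>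

definition closed_loop_step ::
  "(real^'n \<Rightarrow> real^'m \<Rightarrow> real^'n) \<Rightarrow> (real^'m) set \<Rightarrow> real^'n^'n \<Rightarrow> real^'m^'m \<Rightarrow> real^'n^'n \<Rightarrow>
   real \<Rightarrow> real \<Rightarrow> real \<Rightarrow> real \<Rightarrow> real \<Rightarrow> (real \<Rightarrow> real^'n) \<Rightarrow> (real \<Rightarrow> real^'n) \<Rightarrow>
   real \<Rightarrow> real \<Rightarrow> (real \<Rightarrow> real^'m) \<Rightarrow> (real \<Rightarrow> real^'n) \<Rightarrow> (real \<Rightarrow> real^'n) \<Rightarrow> bool" where
  "closed_loop_step f U Q R P T \<alpha> \<epsilon> M \<delta> w x tk tk1 u xh xa \<longleftrightarrow>
     mpc_optimal f U Q R P T \<alpha> \<epsilon> M tk (x tk) u xh \<and>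
     xa tk = x tk \<and>
     solves_ode (\<lambda>s y. f y (u s) + w s) xa tk (tk + T) \<and>
     ereal tk1 = min (ereal tk + trigger_interval P \<delta> tk xa xh) (ereal (tk + T)) \<and>
     solves_ode (\<lambda>s y. f y (u s) + w s) x tk tk1"

end

theory Submission
  imports Defs
begin

text \<open>
  The proof constructs a feasible candidate at the next triggering instant \<open>t\<^sub>1 = t\<^sub>0 + h\<close>: keep the
  old optimal control until \<open>t\<^sub>0 + T\<close>, where it ends, and then apply the terminal feedback \<open>K x\<close>.
  Everything is measured in \<open>\<parallel>x\<parallel>\<^sub>P = \<parallel>\<surd>P x\<parallel>\<close>, in which the field is \<open>L\<close>-Lipschitz and the
  disturbance is bounded by \<open>p = \<rho> \<lambda>\<^sub>m\<^sub>a\<^sub>x(\<surd>P)\<close>; the spectral theorem for symmetric matrices provides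
  \<open>\<surd>P\<close> and the eigenvalue bounds.

  Three estimates carry the argument. First, by a Gronwall comparison the accumulated prediction error
  after time \<open>r\<close> is at most \<open>p \<integral>\<^sub>0\<^sup>r s e\<^sup>L\<^sup>s ds\<close>, and \<open>\<delta>\<close> is this quantity at \<open>r = \<beta>T\<close>.
  Hence the trigger cannot fire before \<open>\<beta>T\<close> (\<open>integrated_error_le\<close>, \<open>trigger_time_bounds\<close>), while at
  \<open>t\<^sub>1\<close> the accumulated error is still at most \<open>\<delta>\<close>.

  Second, the pointwise error at \<open>t\<^sub>1\<close> is therefore at most \<open>L\<delta> + p h\<close>, and it grows at most by the
  factor \<open>exp (L (T - h))\<close> until \<open>t\<^sub>0 + T\<close>. Since \<open>L\<beta>T > 1\<close>, the product decreases in \<open>h\<close>, so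
  \<open>h = \<beta>T\<close> is the worst case, and there the condition on the disturbance makes it at most
  \<open>(1 - \<alpha>)\<epsilon>\<close> (\<open>deviation_at_trigger_le\<close>). So the candidate reaches \<open>\<Omega>(\<epsilon>)\<close> at \<open>t\<^sub>0 + T\<close>. Moving the
  sampling instant by \<open>h \<ge> \<beta>T\<close> raises the robustness bound by \<open>h (M - 1) \<alpha>\<epsilon> / T\<close>, which
  \<open>M \<ge> 1 - 1/\<beta> + 1/(\<alpha>\<beta>)\<close> makes at least \<open>(1 - \<alpha>)\<epsilon>\<close>: the constraint survives on the old horizon.

  Third, on \<open>[t\<^sub>0 + T, t\<^sub>1 + T]\<close> the Lyapunov inequality gives exponential decay of the candidate
  (\<open>terminal_trajectory\<close>), by at least the factor \<open>\<alpha>\<close> by the end because \<open>h \<ge> \<beta>T\<close> and \<open>T\<close> is large.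
  The robustness bound is affine there, the exponential is convex, and it lies below the bound at both
  ends (\<open>exp_le_line\<close>, \<open>mpc_candidate_feasible\<close>).

  The candidate trajectories have to be shown to exist; this is a Picard argument for fields that are
  integrable in time and globally Lipschitz in the state (\<open>solves_ode_exists\<close>). The bound on \<open>\<rho>\<close> is
  the disturbance condition solved for \<open>\<rho>\<close>.
\<close>

section \<open>Symmetric and positive definite matrices\<close>

lemma symmetric_inner_swap:
  fixes A :: "real^'n^'n"
  assumes "transpose A = A"
  shows "(A *v x) \<bullet> y = x \<bullet> (A *v y)"
  by (metis assms dot_lmul_matrix vector_transpose_matrix)

text \<open>A maximiser of the quadratic form on the unit sphere of \<open>V\<close> is an eigenvector: its first variation
  in any direction of \<open>V\<close> orthogonal to it vanishes, so \<open>A v - l v\<close> is orthogonal to itself.\<close>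

lemma symmetric_eigenvector_on_subspace:
  fixes A :: "real^'n^'n"
  assumes sym: "transpose A = A" and V: "subspace V" "\<And>v. v \<in> V \<Longrightarrow> A *v v \<in> V" "V \<noteq> {0}"
  obtains v l where "v \<in> V" "norm v = 1" "A *v v = l *\<^sub>R v"
proof -
  let ?q = "\<lambda>x. x \<bullet> (A *v x)"
  obtain z where z: "z \<in> V" "z \<noteq> 0"
    using V(1,3) subspace_0 by blast
  have "(1 / norm z) *\<^sub>R z \<in> V \<inter> sphere 0 1"
    using z V(1) by (simp add: subspace_scale)
  then have "V \<inter> sphere 0 1 \<noteq> {}" by blast
  moreover have "compact (V \<inter> sphere 0 1)"
    using closed_subspace[OF V(1)] by (simp add: closed_Int_compact)
  moreover have "continuous_on (V \<inter> sphere 0 1) ?q"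
    by (intro continuous_intros linear_continuous_on) (simp add: linear_linear)
  ultimately obtain v where v: "v \<in> V \<inter> sphere 0 1" "\<And>x. x \<in> V \<inter> sphere 0 1 \<Longrightarrow> ?q x \<le> ?q v"
    using continuous_attains_sup[of "V \<inter> sphere 0 1" ?q] by blast
  define l where "l = ?q v"
  have vV: "v \<in> V" and nv: "norm v = 1" using v by auto
  have q_le: "?q x \<le> l * (norm x)\<^sup>2" if "x \<in> V" for x
  proof (cases "x = 0")
    case False
    have "(1 / norm x) *\<^sub>R x \<in> V \<inter> sphere 0 1"
      using that False V(1) by (simp add: subspace_scale)
    from v(2)[OF this] have "?q x / (norm x)\<^sup>2 \<le> l"
      by (simp add: l_def matrix_vector_mult_scaleR power2_eq_square)
    then show ?thesis using False by (simp add: pos_divide_le_eq)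
  qed simp
  have orth: "(A *v v) \<bullet> w = 0" if w: "w \<in> V" "v \<bullet> w = 0" for w
  proof -
    define c d where "c = (A *v v) \<bullet> w" and "d = l * (norm w)\<^sup>2 - ?q w"
    have *: "2 * r * c \<le> r\<^sup>2 * d" for r
    proof -
      have "v + r *\<^sub>R w \<in> V" using vV w V(1) by (simp add: subspace_add subspace_scale)
      from q_le[OF this] have "?q (v + r *\<^sub>R w) \<le> l * (norm (v + r *\<^sub>R w))\<^sup>2" .
      moreover have "(norm (v + r *\<^sub>R w))\<^sup>2 = 1 + r\<^sup>2 * (norm w)\<^sup>2"
        unfolding power2_norm_eq_inner
        using nv w by (simp add: norm_eq_1 inner_add inner_commute power2_eq_square)
      moreover have "?q (v + r *\<^sub>R w) = l + 2 * r * c + r\<^sup>2 * ?q w"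
        using symmetric_inner_swap[OF sym, of v w]
        by (simp add: matrix_vector_right_distrib matrix_vector_mult_scaleR inner_add l_def c_def
            inner_commute power2_eq_square algebra_simps)
      ultimately show ?thesis by (simp add: d_def algebra_simps)
    qed
    show ?thesis
    proof (rule ccontr)
      assume "\<not> ?thesis"
      then have c: "c \<noteq> 0" by (simp add: c_def)
      \<comment> \<open>A step so small that the term linear in \<open>r\<close> dominates; \<open>d\<close> may have either sign or vanish.\<close>
      define r where "r = c / (\<bar>d\<bar> + 1)"
      have "2 * r * c = 2 * c\<^sup>2 / (\<bar>d\<bar> + 1)" by (simp add: r_def power2_eq_square)
      moreover have "r\<^sup>2 * d \<le> c\<^sup>2 / (\<bar>d\<bar> + 1)"
      proof -
        have "r\<^sup>2 * d \<le> r\<^sup>2 * (\<bar>d\<bar> + 1)" by (intro mult_left_mono) auto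
        also have "\<dots> = c\<^sup>2 / (\<bar>d\<bar> + 1)"
          by (simp add: r_def power2_eq_square)
        finally show ?thesis .
      qed
      moreover have "c\<^sup>2 / (\<bar>d\<bar> + 1) > 0" using c by (simp add: add_nonneg_pos)
      ultimately show False using *[of r] by linarith
    qed
  qed
  define w where "w = A *v v - l *\<^sub>R v"
  have "w \<in> V" using V vV by (simp add: w_def subspace_diff subspace_scale)
  moreover have vw: "v \<bullet> w = 0"
    using nv by (simp add: w_def inner_diff l_def norm_eq_sqrt_inner)
  ultimately have "(A *v v) \<bullet> w = 0" by (rule orth)
  moreover have "w \<bullet> w = (A *v v) \<bullet> w - l * (v \<bullet> w)"
    by (subst w_def) (simp add: inner_diff_left)
  ultimately have "w \<bullet> w = 0" using vw by simp
  then have "A *v v = l *\<^sub>R v" by (simp add: w_def)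
  with vV nv that show ?thesis by blast
qed

text \<open>The spectral theorem, by splitting off one eigenvector at a time; invariant subspaces are what makes
  the induction go through, since the orthogonal complement of an eigenvector is again invariant.\<close>

lemma symmetric_eigenbasis_subspace:
  fixes A :: "real^'n^'n"
  assumes sym: "transpose A = A" and "subspace V" "\<And>v. v \<in> V \<Longrightarrow> A *v v \<in> V"
  shows "\<exists>B. finite B \<and> pairwise orthogonal B \<and> (\<forall>b\<in>B. norm b = 1 \<and> (\<exists>l. A *v b = l *\<^sub>R b))
      \<and> span B = V"
  using assms(2,3)
proof (induction "dim V" arbitrary: V rule: less_induct)
  case less
  show ?case
  proof (cases "V = {0}")
    case True
    then show ?thesis by (intro exI[of _ "{}"]) auto
  next
    case False
    obtain v l where v: "v \<in> V" "norm v = 1" "A *v v = l *\<^sub>R v"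
      using symmetric_eigenvector_on_subspace[OF sym less.prems False] by blast
    define V' where "V' = V \<inter> {w. v \<bullet> w = 0}"
    have sub: "subspace V'"
      unfolding V'_def using less.prems(1) subspace_hyperplane by (intro subspace_inter)
    have inv: "A *v w \<in> V'" if "w \<in> V'" for w
    proof -
      have "v \<bullet> (A *v w) = l * (v \<bullet> w)"
        using symmetric_inner_swap[OF sym, of v w] v by simp
      then show ?thesis using that less.prems(2) by (auto simp: V'_def)
    qed
    have "v \<notin> V'" using v by (auto simp: V'_def)
    then have "V' \<subset> V" using v unfolding V'_def by blast
    then have "dim V' < dim V"
      using sub less.prems(1) by (intro dim_psubset) (simp add: span_eq_iff[THEN iffD2])
    from less.hyps[OF this sub inv] obtain B where B: "finite B" "pairwise orthogonal B"
      "\<forall>b\<in>B. norm b = 1 \<and> (\<exists>l. A *v b = l *\<^sub>R b)" "span B = V'" by blast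
    have BV': "B \<subseteq> V'" using B(4) span_superset by blast
    have "pairwise orthogonal (insert v B)"
      using B(2) BV' by (auto simp: pairwise_insert orthogonal_def V'_def inner_commute)
    moreover have "span (insert v B) = V"
    proof
      show "span (insert v B) \<subseteq> V"
        using BV' v less.prems(1) by (intro span_minimal) (auto simp: V'_def)
      show "V \<subseteq> span (insert v B)"
      proof
        fix x assume x: "x \<in> V"
        have "x - (x \<bullet> v) *\<^sub>R v \<in> V'"
          using x v less.prems(1)
          by (simp add: V'_def subspace_diff subspace_scale inner_diff inner_commute norm_eq_sqrt_inner)
        then show "x \<in> span (insert v B)"
          using B(4) by (auto simp: span_insert)
      qed
    qed
    ultimately show ?thesis using B v by (intro exI[of _ "insert v B"]) auto
  qed
qed

lemma symmetric_eigenbasis: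
  fixes A :: "real^'n^'n"
  assumes "transpose A = A"
  obtains B l where "finite B" "pairwise orthogonal B" "\<And>b. b \<in> B \<Longrightarrow> norm b = 1"
    "\<And>b. b \<in> B \<Longrightarrow> A *v b = l b *\<^sub>R b" "span B = (UNIV :: (real^'n) set)"
proof -
  obtain B where B: "finite B" "pairwise orthogonal B"
      "\<forall>b\<in>B. norm b = 1 \<and> (\<exists>l. A *v b = l *\<^sub>R b)" "span B = (UNIV :: (real^'n) set)"
    using symmetric_eigenbasis_subspace[OF assms, of UNIV] by auto
  then obtain l where "\<forall>b\<in>B. A *v b = l b *\<^sub>R b" by metis
  with B that show ?thesis by blast
qed

lemma inner_orthonormal_expansion:
  fixes B :: "'a::euclidean_space set"
  assumes B: "finite B" "pairwise orthogonal B" "\<And>b. b \<in> B \<Longrightarrow> norm b = 1" "span B = UNIV"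
  shows "x \<bullet> y = (\<Sum>b\<in>B. (x \<bullet> b) * (y \<bullet> b))"
proof -
  have "x = (\<Sum>b\<in>B. (x \<bullet> b) *\<^sub>R b)"
    using orthonormal_basis_expand[OF B(2,3) _ B(1), of x] B(4) by simp
  then have "x \<bullet> y = (\<Sum>b\<in>B. (x \<bullet> b) *\<^sub>R b) \<bullet> y" by simp
  also have "\<dots> = (\<Sum>b\<in>B. (x \<bullet> b) * (y \<bullet> b))"
    unfolding inner_sum_left by (intro sum.cong refl) (simp add: inner_commute)
  finally show ?thesis .
qed

lemma eigenvalues_eigenbasis:
  fixes A :: "real^'n^'n"
  assumes sym: "transpose A = A"
    and B: "finite B" "pairwise orthogonal B" "\<And>b. b \<in> B \<Longrightarrow> norm b = 1" "span B = UNIV"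
    and l: "\<And>b. b \<in> B \<Longrightarrow> A *v b = l b *\<^sub>R b"
  shows "eigenvalues A = l ` B"
proof
  show "l ` B \<subseteq> eigenvalues A"
  proof
    fix m assume "m \<in> l ` B"
    then obtain b where "b \<in> B" "m = l b" by blast
    then show "m \<in> eigenvalues A"
      using l[of b] B(3)[of b] by (auto simp: eigenvalues_def scalar_mult_eq_scaleR intro!: exI[of _ b])
  qed
  show "eigenvalues A \<subseteq> l ` B"
  proof
    fix m assume "m \<in> eigenvalues A"
    then obtain v where v: "v \<noteq> 0" "A *v v = m *\<^sub>R v"
      by (auto simp: eigenvalues_def scalar_mult_eq_scaleR)
    have "v \<bullet> v \<noteq> 0" using v by simp
    then obtain b where b: "b \<in> B" "v \<bullet> b \<noteq> 0"
      using inner_orthonormal_expansion[OF B, of v v] by (metis (no_types, lifting) mult_zero_left sum.neutral)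
    have "m * (v \<bullet> b) = l b * (v \<bullet> b)"
      using symmetric_inner_swap[OF sym, of v b] v l[OF b(1)] by simp
    then show "m \<in> l ` B" using b by auto
  qed
qed

lemma finite_eigenvalues_symmetric:
  fixes A :: "real^'n^'n"
  assumes "transpose A = A"
  shows "finite (eigenvalues A)" "eigenvalues A \<noteq> {}"
proof -
  obtain B l where B: "finite B" "pairwise orthogonal B" "\<And>b. b \<in> B \<Longrightarrow> norm b = 1"
    "\<And>b. b \<in> B \<Longrightarrow> A *v b = l b *\<^sub>R b" "span B = (UNIV :: (real^'n) set)"
    by (rule symmetric_eigenbasis[OF assms]) blast
  have *: "eigenvalues A = l ` B" by (rule eigenvalues_eigenbasis[OF assms B(1,2,3,5,4)])
  show "finite (eigenvalues A)" using * B(1) by simp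
  obtain z :: "real^'n" where "z \<noteq> 0" by (metis axis_eq_0_iff zero_neq_one)
  then have "B \<noteq> {}" using B(5) by force
  then show "eigenvalues A \<noteq> {}" using * by simp
qed

lemma symmetric_quadratic_form_bounds:
  fixes A :: "real^'n^'n"
  assumes sym: "transpose A = A"
  shows "x \<bullet> (A *v x) \<le> lambda_max A * (norm x)\<^sup>2"
    and "lambda_min A * (norm x)\<^sup>2 \<le> x \<bullet> (A *v x)"
proof -
  obtain B l where B: "finite B" "pairwise orthogonal B" "\<And>b. b \<in> B \<Longrightarrow> norm b = 1"
    "\<And>b. b \<in> B \<Longrightarrow> A *v b = l b *\<^sub>R b" "span B = (UNIV :: (real^'n) set)"
    by (rule symmetric_eigenbasis[OF assms]) blast
  have ev: "eigenvalues A = l ` B" by (rule eigenvalues_eigenbasis[OF assms B(1,2,3,5,4)])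
  have ex: "y \<bullet> z = (\<Sum>b\<in>B. (y \<bullet> b) * (z \<bullet> b))" for y z
    by (rule inner_orthonormal_expansion[OF B(1,2) _ B(5)]) (rule B(3))
  have q: "x \<bullet> (A *v x) = (\<Sum>b\<in>B. l b * (x \<bullet> b)\<^sup>2)"
  proof -
    have "(x \<bullet> b) * ((A *v x) \<bullet> b) = l b * (x \<bullet> b)\<^sup>2" if "b \<in> B" for b
      using symmetric_inner_swap[OF sym, of x b] B(4)[OF that] by (simp add: power2_eq_square)
    then show ?thesis by (simp add: ex[where y = x and z = "A *v x"])
  qed
  have n: "(norm x)\<^sup>2 = (\<Sum>b\<in>B. (x \<bullet> b)\<^sup>2)"
    unfolding power2_norm_eq_inner ex[of x x] by (simp add: power2_eq_square)
  show "x \<bullet> (A *v x) \<le> lambda_max A * (norm x)\<^sup>2"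
    unfolding q n sum_distrib_left lambda_max_def ev
    using B(1) by (intro sum_mono mult_right_mono Max_ge) auto
  show "lambda_min A * (norm x)\<^sup>2 \<le> x \<bullet> (A *v x)"
    unfolding q n sum_distrib_left lambda_min_def ev
    using B(1) by (intro sum_mono mult_right_mono Min_le) auto
qed

lemma pos_def_eigenvalue_pos:
  assumes "pos_def S" "l \<in> eigenvalues S"
  shows "l > 0"
proof -
  obtain v where v: "v \<noteq> 0" "S *v v = l *\<^sub>R v"
    using assms(2) by (auto simp: eigenvalues_def scalar_mult_eq_scaleR)
  then have "0 < l * (v \<bullet> v)" using assms(1) by (metis pos_def_def inner_scaleR_right)
  moreover have "0 < v \<bullet> v" using v by simp
  ultimately show ?thesis by (rule zero_less_mult_pos2)
qed

lemma pos_def_lambda_pos: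
  assumes "pos_def S"
  shows "lambda_min S > 0" "lambda_max S > 0"
  using finite_eigenvalues_symmetric[of S] pos_def_eigenvalue_pos[OF assms] assms
  by (auto simp: pos_def_def lambda_min_def lambda_max_def Max_gr_iff)

lemma pos_def_nonneg:
  assumes "pos_def S"
  shows "0 \<le> x \<bullet> (S *v x)"
  using assms by (cases "x = 0") (auto simp: pos_def_def less_imp_le)

text \<open>Squaring the norm leads to the eigenvalues of \<open>S\<^sup>2\<close>; positivity of \<open>S\<close> is what makes the largest
  eigenvalue also the largest in absolute value.\<close>

lemma pos_def_norm_mult_le:
  assumes "pos_def S"
  shows "norm (S *v x) \<le> lambda_max S * norm x"
proof -
  have sym: "transpose S = S" using assms by (simp add: pos_def_def)
  obtain B l where B: "finite B" "pairwise orthogonal B" "\<And>b. b \<in> B \<Longrightarrow> norm b = 1"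
    "\<And>b. b \<in> B \<Longrightarrow> S *v b = l b *\<^sub>R b" "span B = (UNIV :: (real^'a) set)"
    by (rule symmetric_eigenbasis[OF sym]) blast
  have ev: "eigenvalues S = l ` B" by (rule eigenvalues_eigenbasis[OF sym B(1,2,3,5,4)])
  have ex: "y \<bullet> z = (\<Sum>b\<in>B. (y \<bullet> b) * (z \<bullet> b))" for y z
    by (rule inner_orthonormal_expansion[OF B(1,2) _ B(5)]) (rule B(3))
  have l: "0 \<le> l b" "l b \<le> lambda_max S" if "b \<in> B" for b
    using that B(1) pos_def_eigenvalue_pos[OF assms, of "l b"]
    by (auto simp: ev lambda_max_def less_imp_le)
  have q: "(norm (S *v x))\<^sup>2 = (\<Sum>b\<in>B. (l b)\<^sup>2 * (x \<bullet> b)\<^sup>2)"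
  proof -
    have "((S *v x) \<bullet> b) * ((S *v x) \<bullet> b) = (l b)\<^sup>2 * (x \<bullet> b)\<^sup>2" if "b \<in> B" for b
      using symmetric_inner_swap[OF sym, of x b] B(4)[OF that] by (simp add: power2_eq_square)
    then show ?thesis by (simp add: power2_norm_eq_inner ex[where y = "S *v x" and z = "S *v x"])
  qed
  have n: "(norm x)\<^sup>2 = (\<Sum>b\<in>B. (x \<bullet> b)\<^sup>2)"
    unfolding power2_norm_eq_inner ex[of x x] by (simp add: power2_eq_square)
  have "(norm (S *v x))\<^sup>2 \<le> (lambda_max S * norm x)\<^sup>2"
    unfolding q n power_mult_distrib sum_distrib_left
    using l by (intro sum_mono mult_right_mono power_mono) auto
  then show ?thesis
    using pos_def_lambda_pos(2)[OF assms] by (simp add: abs_le_square_iff[symmetric])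
qed

lemma pos_def_plus_congruence:
  fixes K :: "real^'n^'m"
  assumes Q: "pos_def Q" and R: "pos_def R"
  shows "pos_def (Q + transpose K ** R ** K)"
proof -
  have "transpose (transpose K ** R ** K) = transpose K ** R ** K"
    using R by (simp add: pos_def_def matrix_transpose_mul matrix_mul_assoc)
  then have "transpose (Q + transpose K ** R ** K) = Q + transpose K ** R ** K"
    using Q by (simp add: pos_def_def transpose_def vec_eq_iff)
  moreover have "0 < y \<bullet> ((Q + transpose K ** R ** K) *v y)" if "y \<noteq> 0" for y
  proof -
    have "y \<bullet> ((transpose K ** R ** K) *v y) = (K *v y) \<bullet> (R *v (K *v y))"
      using dot_lmul_matrix[of y "transpose K" "R *v (K *v y)"]
      by (simp add: matrix_vector_mul_assoc[symmetric] vector_transpose_matrix)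
    then show ?thesis
      using Q that pos_def_nonneg[OF R, of "K *v y"]
      by (simp add: pos_def_def matrix_vector_mult_add_rdistrib inner_add_right add_pos_nonneg)
  qed
  ultimately show ?thesis by (simp add: pos_def_def)
qed

lemma pos_def_sqrt_exists:
  fixes P :: "real^'n^'n"
  assumes "pos_def P"
  shows "\<exists>S. pos_def S \<and> S ** S = P"
proof -
  have sym: "transpose P = P" using assms by (simp add: pos_def_def)
  obtain B l where B: "finite B" "pairwise orthogonal B" "\<And>b. b \<in> B \<Longrightarrow> norm b = 1"
    "\<And>b. b \<in> B \<Longrightarrow> P *v b = l b *\<^sub>R b" "span B = (UNIV :: (real^'n) set)"
    by (rule symmetric_eigenbasis[OF sym]) blast
  have ev: "eigenvalues P = l ` B" by (rule eigenvalues_eigenbasis[OF sym B(1,2,3,5,4)])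
  have ex: "y \<bullet> z = (\<Sum>b\<in>B. (y \<bullet> b) * (z \<bullet> b))" for y z
    by (rule inner_orthonormal_expansion[OF B(1,2) _ B(5)]) (rule B(3))
  have l: "0 < l b" if "b \<in> B" for b
    using that pos_def_eigenvalue_pos[OF assms] by (auto simp: ev)
  \<comment> \<open>The operator that replaces each eigenvalue by its root; its matrix is the square root.\<close>
  define s where "s x = (\<Sum>b\<in>B. (sqrt (l b) * (x \<bullet> b)) *\<^sub>R b)" for x
  define S where "S = matrix s"
  have "linear s"
    by (rule linearI) (simp_all add: s_def inner_add_left algebra_simps sum.distrib scaleR_sum_right)
  then have S: "S *v x = s x" for x by (simp add: S_def matrix_works)
  have orth: "b \<bullet> c = (if b = c then 1 else 0)" if "b \<in> B" "c \<in> B" for b c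
    using that B(2,3) by (auto simp: pairwise_def orthogonal_def norm_eq_1)
  have sb: "s x \<bullet> c = sqrt (l c) * (x \<bullet> c)" if "c \<in> B" for x c
  proof -
    have "s x \<bullet> c = (\<Sum>b\<in>B. if b = c then sqrt (l b) * (x \<bullet> b) else 0)"
      unfolding s_def inner_sum_left using that by (intro sum.cong refl) (simp add: orth)
    then show ?thesis using that B(1) by simp
  qed
  have xs: "x \<bullet> s y = (\<Sum>b\<in>B. sqrt (l b) * (x \<bullet> b) * (y \<bullet> b))" for x y
  proof -
    have *: "(x \<bullet> b) * (s y \<bullet> b) = sqrt (l b) * (x \<bullet> b) * (y \<bullet> b)" if "b \<in> B" for b
      using sb[OF that] by simp
    show ?thesis unfolding ex[where y = x and z = "s y"] by (intro sum.cong refl *)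
  qed
  have "transpose S = S"
  proof -
    have "s x \<bullet> y = x \<bullet> s y" for x y
      unfolding inner_commute[of "s x" y] xs by (simp add: mult_ac)
    then have "(\<lambda>x. transpose S *v x) = (\<lambda>x. S *v x)"
      unfolding adjoint_matrix[symmetric] by (intro adjoint_unique) (simp add: S)
    then show ?thesis by (metis matrix_eq)
  qed
  moreover have "0 < x \<bullet> (S *v x)" if "x \<noteq> 0" for x
  proof -
    have "x \<bullet> x \<noteq> 0" using that by simp
    then obtain b where b: "b \<in> B" "x \<bullet> b \<noteq> 0"
      using ex[of x x] by (metis (no_types, lifting) mult_zero_left sum.neutral)
    have "0 < (\<Sum>b\<in>B. sqrt (l b) * (x \<bullet> b) * (x \<bullet> b))"
      using b l by (intro sum_pos2[OF B(1) b(1)])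
        (auto simp: mult.assoc less_imp_le zero_less_mult_iff zero_le_mult_iff)
    then show ?thesis by (simp add: S xs)
  qed
  moreover have "S ** S = P"
  proof -
    have "s (s x) = P *v x" for x
    proof -
      have "(s (s x) - P *v x) \<bullet> c = 0" if "c \<in> B" for c
        using that sb l[OF that] B(4) by (simp add: inner_diff_left symmetric_inner_swap[OF sym])
      then have "(s (s x) - P *v x) \<bullet> (s (s x) - P *v x) = 0"
        by (subst ex) simp
      then show ?thesis by simp
    qed
    then show ?thesis by (simp add: matrix_eq S matrix_vector_mul_assoc[symmetric])
  qed
  ultimately show ?thesis by (auto simp: pos_def_def)
qed

text \<open>The diagonal entries of \<open>D S D\<close> are the values of the quadratic form of \<open>S\<close> at the columns of \<open>D\<close>.\<close>

lemma trace_congruence_nonneg: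
  fixes D S :: "real^'n^'n"
  assumes "transpose D = D" "pos_def S"
  shows "0 \<le> trace (D ** S ** D)" "trace (D ** S ** D) = 0 \<Longrightarrow> D = 0"
proof -
  have diag: "(D ** S ** D) $ i $ i = (D *v axis i 1) \<bullet> (S *v (D *v axis i 1))" for i
  proof -
    have "(D ** S ** D) $ i $ i = axis i 1 \<bullet> ((D ** S ** D) *v axis i 1)"
      by (simp add: inner_axis' matrix_vector_mult_basis column_def)
    also have "\<dots> = (D *v axis i 1) \<bullet> (S *v (D *v axis i 1))"
      by (simp add: matrix_vector_mul_assoc[symmetric] symmetric_inner_swap[OF assms(1)])
    finally show ?thesis .
  qed
  show "0 \<le> trace (D ** S ** D)"
    unfolding trace_def by (simp add: diag sum_nonneg pos_def_nonneg[OF assms(2)])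
  assume "trace (D ** S ** D) = 0"
  then have "(D *v axis i 1) \<bullet> (S *v (D *v axis i 1)) = 0" for i
    unfolding trace_def by (simp add: diag sum_nonneg_eq_0_iff pos_def_nonneg[OF assms(2)])
  then have "D *v axis i 1 = 0" for i
    using assms(2) by (metis pos_def_def less_irrefl)
  then show "D = 0"
    by (simp add: matrix_vector_mult_basis column_def vec_eq_iff)
qed

text \<open>For \<open>D = S - S'\<close> the hypothesis reads \<open>S D + D S' = 0\<close>. Multiplying by \<open>D\<close> and taking traces
  gives two nonnegative numbers with sum zero.\<close>

lemma pos_def_sqrt_unique:
  fixes S S' :: "real^'n^'n"
  assumes S: "pos_def S" "pos_def S'" and sq: "S ** S = S' ** S'"
  shows "S = S'"
proof -
  define D where "D = S - S'"
  have sym: "transpose D = D"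
    using S by (simp add: D_def pos_def_def transpose_def vec_eq_iff)
  have "S ** D + D ** S' = 0"
  proof -
    have "S ** D = S ** S - S ** S'" "D ** S' = S ** S' - S' ** S'"
      by (simp_all add: D_def matrix_matrix_mult_def vec_eq_iff algebra_simps sum_subtractf)
    then show ?thesis using sq by simp
  qed
  then have "D ** (S ** D + D ** S') = 0" by simp
  then have "trace (D ** S ** D) + trace (D ** (D ** S')) = 0"
    by (simp add: matrix_add_ldistrib matrix_mul_assoc trace_add[symmetric] trace_0[unfolded mat_0])
  moreover have "trace (D ** (D ** S')) = trace (D ** S' ** D)"
    by (rule trace_mul_sym)
  ultimately have "trace (D ** S ** D) = 0"
    using trace_congruence_nonneg(1)[OF sym S(1)] trace_congruence_nonneg(1)[OF sym S(2)] by simp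
  then have "D = 0" by (rule trace_congruence_nonneg(2)[OF sym S(1)])
  then show ?thesis by (simp add: D_def)
qed

lemma matrix_sqrt_pos_def:
  assumes "pos_def P"
  shows "pos_def (matrix_sqrt P)" "matrix_sqrt P ** matrix_sqrt P = P"
proof -
  have "\<exists>!S. pos_def S \<and> S ** S = P"
    using pos_def_sqrt_exists[OF assms] pos_def_sqrt_unique by blast
  from theI'[OF this] show "pos_def (matrix_sqrt P)" "matrix_sqrt P ** matrix_sqrt P = P"
    by (simp_all add: matrix_sqrt_def)
qed

lemma wnorm_eq_norm_sqrt:
  assumes "pos_def P"
  shows "wnorm P x = norm (matrix_sqrt P *v x)"
proof -
  have "transpose (matrix_sqrt P) = matrix_sqrt P"
    using matrix_sqrt_pos_def(1)[OF assms] by (simp add: pos_def_def)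
  from symmetric_inner_swap[OF this, of x "matrix_sqrt P *v x"]
  show ?thesis
    by (simp add: wnorm_def norm_eq_sqrt_inner matrix_vector_mul_assoc matrix_sqrt_pos_def(2)[OF assms])
qed

section \<open>Caratheodory solutions and integral inequalities\<close>

lemma solves_ode_continuous:
  assumes "solves_ode F x a b"
  shows "continuous_on {a..b} x"
proof (cases "a \<le> b")
  case True
  have hi: "((\<lambda>s. F s (x s)) has_integral (x t - x a)) {a..t}" if "t \<in> {a..b}" for t
    using assms that by (simp add: solves_ode_def)
  have "(\<lambda>s. F s (x s)) integrable_on {a..b}"
    using hi[of b] True by auto
  then have "continuous_on {a..b} (\<lambda>t. x a + integral {a..t} (\<lambda>s. F s (x s)))"
    by (intro continuous_intros indefinite_integral_continuous_1)
  moreover have "x a + integral {a..t} (\<lambda>s. F s (x s)) = x t" if "t \<in> {a..b}" for t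
    using integral_unique[OF hi[OF that]] by simp
  ultimately show ?thesis by (rule continuous_on_eq)
qed simp

lemma solves_ode_subinterval:
  assumes "solves_ode F x a b" "a \<le> c" "d \<le> b"
  shows "solves_ode F x c d"
  unfolding solves_ode_def
proof
  fix t assume t: "t \<in> {c..d}"
  let ?g = "\<lambda>s. F s (x s)"
  have hi: "(?g has_integral (x t - x a)) {a..t}" "(?g has_integral (x c - x a)) {a..c}"
    using assms t by (auto simp: solves_ode_def)
  have "?g integrable_on {c..t}"
    using integrable_subinterval_real[of ?g a t c t] hi(1) assms(2) by auto
  moreover have "integral {a..c} ?g + integral {c..t} ?g = integral {a..t} ?g"
    using hi(1) assms(2) t by (intro Henstock_Kurzweil_Integration.integral_combine) auto
  ultimately show "(?g has_integral (x t - x c)) {c..t}"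
    using hi[THEN integral_unique] by (simp add: has_integral_iff algebra_simps)
qed

lemma solves_ode_combine:
  assumes "solves_ode F x a c" "solves_ode F x c b" "a \<le> c" "c \<le> b"
  shows "solves_ode F x a b"
  unfolding solves_ode_def
proof
  fix t assume t: "t \<in> {a..b}"
  let ?g = "\<lambda>s. F s (x s)"
  show "(?g has_integral (x t - x a)) {a..t}"
  proof (cases "t \<le> c")
    case True
    then show ?thesis using assms(1) t by (simp add: solves_ode_def)
  next
    case False
    have "(?g has_integral ((x c - x a) + (x t - x c))) {a..t}"
      using assms t False by (intro has_integral_combine[of a c t]) (auto simp: solves_ode_def)
    then show ?thesis by simp
  qed
qed

text \<open>Changing the field at finitely many instants does not affect its integrals; this absorbs the jump of
  the control at the point where two controls are joined.\<close>

lemma solves_ode_cong_finite: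
  assumes "solves_ode F x a b" "finite N"
    and "\<And>s. s \<in> {a..b} \<Longrightarrow> y s = x s"
    and "\<And>s. s \<in> {a..b} - N \<Longrightarrow> G s (x s) = F s (x s)"
  shows "solves_ode G y a b"
  unfolding solves_ode_def
proof
  fix t assume t: "t \<in> {a..b}"
  have *: "((\<lambda>s. F s (x s)) has_integral (x t - x a)) {a..t}"
    using assms(1) t by (simp add: solves_ode_def)
  have eq: "G s (y s) = F s (x s)" if "s \<in> {a..t} - N" for s
  proof -
    have s: "s \<in> {a..b}" "s \<in> {a..b} - N" using that t by auto
    show ?thesis unfolding assms(3)[OF s(1)] by (rule assms(4)[OF s(2)])
  qed
  have "y t = x t" "y a = x a" using assms(3) t by auto
  then show "((\<lambda>s. G s (y s)) has_integral (y t - y a)) {a..t}"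
    by (simp only: has_integral_spike_finite[OF assms(2) eq *])
qed

text \<open>The integral of \<open>\<phi>\<close> is a subsolution and \<open>G\<close> a supersolution of \<open>\<Phi>' = c + L \<Phi>\<close>, so
  \<open>(\<integral>\<phi> - G) exp (- L s)\<close> decreases from a nonpositive value. Keeping \<open>G\<close> arbitrary allows supersolutions
  that are not the exact solution, such as the one from which the triggering level is computed.\<close>

lemma integral_inequality_comparison:
  fixes \<phi> c G G' :: "real \<Rightarrow> real"
  assumes cont: "continuous_on {a..b} \<phi>"
    and le: "\<And>s. s \<in> {a..b} \<Longrightarrow> \<phi> s \<le> c s + L * integral {a..s} \<phi>"
    and G: "\<And>s. (G has_real_derivative G' s) (at s)"
    and G': "\<And>s. s \<in> {a..b} \<Longrightarrow> c s + L * G s \<le> G' s"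
    and "0 \<le> G a" and t: "t \<in> {a..b}"
  shows "integral {a..t} \<phi> \<le> G t"
proof -
  let ?\<Phi> = "\<lambda>s. integral {a..s} \<phi>"
  define D where "D s = (?\<Phi> s - G s) * exp (- L * s)" for s
  have "D t \<le> D a"
  proof (rule DERIV_nonpos_imp_decreasing_open[where f = D and a = a and b = t])
    show "a \<le> t" using t by simp
    show "continuous_on {a..t} D"
    proof -
      have "continuous_on {a..t} \<phi>" using cont t by (auto elim: continuous_on_subset)
      moreover have "continuous_on {a..t} G"
        by (rule DERIV_continuous_on[OF has_field_derivative_at_within[OF G]])
      ultimately show ?thesis unfolding D_def
        by (intro continuous_intros indefinite_integral_continuous_1 integrable_continuous_interval)
    qed
    fix s assume s: "a < s" "s < t"
    have "(?\<Phi> has_real_derivative \<phi> s) (at s within {a..t})"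
      using s t cont by (intro integral_has_real_derivative) (auto elim: continuous_on_subset)
    then have "(?\<Phi> has_real_derivative \<phi> s) (at s)"
      using s by (simp add: at_within_Icc_at)
    then have "(D has_real_derivative
        (\<phi> s - G' s) * exp (- L * s) + (?\<Phi> s - G s) * (exp (- L * s) * - L)) (at s)"
      unfolding D_def by (auto intro!: derivative_eq_intros G)
    moreover have "(\<phi> s - G' s) * exp (- L * s) + (?\<Phi> s - G s) * (exp (- L * s) * - L)
        = (\<phi> s - G' s - L * (?\<Phi> s - G s)) * exp (- L * s)"
      by (simp add: algebra_simps)
    moreover have "\<phi> s - G' s - L * (?\<Phi> s - G s) \<le> 0"
      using le[of s] G'[of s] s t by (simp add: algebra_simps)
    ultimately show "\<exists>y. (D has_real_derivative y) (at s) \<and> y \<le> 0"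
      by (metis exp_ge_zero mult_nonpos_nonneg)
  qed
  also have "D a \<le> 0" using \<open>0 \<le> G a\<close> by (simp add: D_def)
  finally show ?thesis by (simp add: D_def mult_le_0_iff)
qed

lemma gronwall_inequality:
  fixes \<phi> :: "real \<Rightarrow> real"
  assumes cont: "continuous_on {a..b} \<phi>" and L: "0 < L"
    and le: "\<And>s. s \<in> {a..b} \<Longrightarrow> \<phi> s \<le> c + L * integral {a..s} \<phi>"
    and t: "t \<in> {a..b}"
  shows "\<phi> t \<le> c * exp (L * (t - a))"
proof -
  have "integral {a..t} \<phi> \<le> c / L * (exp (L * (t - a)) - 1)"
  proof (rule integral_inequality_comparison[OF cont le _ _ _ t])
    fix s
    show "((\<lambda>s. c / L * (exp (L * (s - a)) - 1)) has_real_derivative c * exp (L * (s - a))) (at s)"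
      using L by (auto intro!: derivative_eq_intros)
    show "c + L * (c / L * (exp (L * (s - a)) - 1)) \<le> c * exp (L * (s - a))"
      using L by (simp add: algebra_simps)
  qed auto
  then have "L * integral {a..t} \<phi> \<le> L * (c / L * (exp (L * (t - a)) - 1))"
    using L by (intro mult_left_mono) auto
  also have "\<dots> = c * exp (L * (t - a)) - c" using L by (simp add: algebra_simps)
  finally show ?thesis using le[OF t] by linarith
qed

text \<open>The estimate is stated for the image under a linear map \<open>S\<close>, because the field is Lipschitz in a
  weighted norm, which is the Euclidean norm after applying the square root of the weight.\<close>

lemma solves_ode_difference_bound:
  fixes x y :: "real \<Rightarrow> 'a::euclidean_space" and S :: "'a \<Rightarrow> 'b::euclidean_space"
  assumes S: "bounded_linear S" and x: "solves_ode F x a b" and y: "solves_ode G y a b"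
    and le: "\<And>s. s \<in> {a..b} \<Longrightarrow>
      norm (S (F s (x s) - G s (y s))) \<le> L * norm (S (x s - y s)) + p"
    and t: "t \<in> {a..b}"
  shows "norm (S (x t - y t)) \<le> norm (S (x a - y a)) + p * (t - a)
           + L * integral {a..t} (\<lambda>s. norm (S (x s - y s)))"
proof -
  interpret S: bounded_linear S by fact
  let ?\<phi> = "\<lambda>s. norm (S (x s - y s))"
  have "continuous_on {a..b} ?\<phi>"
    by (intro continuous_intros S.continuous_on solves_ode_continuous[OF x]
        solves_ode_continuous[OF y])
  then have int: "?\<phi> integrable_on {a..t}"
    using t by (intro integrable_continuous_interval) (auto elim: continuous_on_subset)
  have "((\<lambda>s. F s (x s) - G s (y s)) has_integral (x t - x a - (y t - y a))) {a..t}"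
    using x y t by (intro has_integral_diff) (auto simp: solves_ode_def)
  from has_integral_linear[OF this S]
  have hi: "((\<lambda>s. S (F s (x s) - G s (y s))) has_integral S (x t - x a - (y t - y a))) {a..t}"
    by (simp add: o_def)
  have "norm (S (x t - x a - (y t - y a))) \<le> integral {a..t} (\<lambda>s. L * ?\<phi> s + p)"
    unfolding integral_unique[OF hi, symmetric]
    using hi le t int
    by (intro integral_norm_bound_integral integrable_add integrable_on_mult_right) auto
  also have "\<dots> = L * integral {a..t} ?\<phi> + p * (t - a)"
    using int t by (subst integral_add) (auto intro: integrable_on_mult_right)
  finally have "norm (S (x t - x a - (y t - y a))) \<le> L * integral {a..t} ?\<phi> + p * (t - a)" .
  moreover have "S (x t - y t) = S (x a - y a) + S (x t - x a - (y t - y a))"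
    by (simp add: S.diff)
  ultimately show ?thesis
    using norm_triangle_ineq[of "S (x a - y a)" "S (x t - x a - (y t - y a))"] by simp
qed

text \<open>Banach's fixed point theorem for the integral operator. Writing a trajectory as
  \<open>exp (2 L (t - a)) \<phi> t\<close> with \<open>\<phi>\<close> in the sup-norm makes the operator a contraction with factor \<open>1 / 2\<close>
  on the whole interval at once. No continuity in time is assumed of the field, only that it can be
  integrated along continuous curves.\<close>

lemma solves_ode_exists:
  fixes F :: "real \<Rightarrow> 'a::euclidean_space \<Rightarrow> 'a"
  assumes ab: "a \<le> b" and L: "0 < L"
    and lip: "\<And>s y z. s \<in> {a..b} \<Longrightarrow> norm (F s y - F s z) \<le> L * norm (y - z)"
    and int: "\<And>y. continuous_on {a..b} y \<Longrightarrow> (\<lambda>s. F s (y s)) integrable_on {a..b}"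
  shows "\<exists>x. x a = x0 \<and> solves_ode F x a b"
proof -
  \<comment> \<open>Bounded continuous functions live on the whole line, so times are clamped to \<open>[a, b]\<close>.\<close>
  define m where "m t = max a (min b t)" for t
  define E where "E t = exp (2 * L * (t - a))" for t
  define h where "h \<phi> t = x0 + integral {a..t} (\<lambda>s. F s (E s *\<^sub>R \<phi> s))" for \<phi> t
  define Z where "Z \<phi> = Bcontfun (\<lambda>t. (1 / E (m t)) *\<^sub>R h (apply_bcontfun \<phi>) (m t))" for \<phi>
  have m: "m t \<in> {a..b}" "t \<in> {a..b} \<Longrightarrow> m t = t" for t
    using ab by (auto simp: m_def)
  have E: "E t > 0" "continuous_on A E" for t A
    by (auto simp: E_def intro!: continuous_intros)
  have inth: "(\<lambda>s. F s (E s *\<^sub>R apply_bcontfun \<phi> s)) integrable_on {a..b}" for \<phi>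
    by (intro int continuous_intros E) auto
  have inth': "(\<lambda>s. F s (E s *\<^sub>R apply_bcontfun \<phi> s)) integrable_on {a..t}"
    if "t \<in> {a..b}" for \<phi> t
    using integrable_subinterval_real[OF inth, of a t] that by auto
  have Z: "apply_bcontfun (Z \<phi>) t = (1 / E (m t)) *\<^sub>R h (apply_bcontfun \<phi>) (m t)" for \<phi> t
  proof -
    let ?k = "\<lambda>t. (1 / E t) *\<^sub>R h (apply_bcontfun \<phi>) t"
    have k: "continuous_on {a..b} ?k"
      unfolding h_def using E(1)
      by (intro continuous_intros indefinite_integral_continuous_1 inth E) (auto simp: less_imp_neq[OF E(1), symmetric])
    have "continuous_on UNIV m" unfolding m_def by (intro continuous_intros)
    then have "continuous_on UNIV (\<lambda>t. ?k (m t))"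
      by (rule continuous_on_compose2[OF k]) (use m in auto)
    moreover have "bounded (range (\<lambda>t. ?k (m t)))"
      using m(1) by (intro bounded_subset[OF compact_imp_bounded[OF
            compact_continuous_image[OF k compact_Icc]]]) blast
    ultimately show ?thesis
      by (simp add: Z_def Bcontfun_inverse bcontfun_def)
  qed
  have "dist (Z \<phi>) (Z \<psi>) \<le> 1 / 2 * dist \<phi> \<psi>" for \<phi> \<psi> :: "(real, 'a) bcontfun"
  proof (rule dist_bound)
    fix t
    define r where "r = m t"
    have r: "r \<in> {a..b}" using m by (simp add: r_def)
    let ?d = "dist \<phi> \<psi>"
    have E_int: "((\<lambda>s. L * E s * ?d) has_integral (E r * ?d / 2 - E a * ?d / 2)) {a..r}"
      using r by (intro fundamental_theorem_of_calculus)
        (auto simp: E_def has_real_derivative_iff_has_vector_derivative[symmetric]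
          intro!: derivative_eq_intros)
    have "h (apply_bcontfun \<phi>) r - h (apply_bcontfun \<psi>) r
        = integral {a..r} (\<lambda>s. F s (E s *\<^sub>R apply_bcontfun \<phi> s) - F s (E s *\<^sub>R apply_bcontfun \<psi> s))"
      using inth'[OF r] by (simp add: h_def integral_diff)
    also have "norm \<dots> \<le> integral {a..r} (\<lambda>s. L * E s * ?d)"
    proof (rule integral_norm_bound_integral)
      fix s assume s: "s \<in> {a..r}"
      have "norm (F s (E s *\<^sub>R apply_bcontfun \<phi> s) - F s (E s *\<^sub>R apply_bcontfun \<psi> s))
          \<le> L * norm (E s *\<^sub>R (apply_bcontfun \<phi> s - apply_bcontfun \<psi> s))"
        using lip[of s "E s *\<^sub>R apply_bcontfun \<phi> s" "E s *\<^sub>R apply_bcontfun \<psi> s"] s r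
        by (simp add: scaleR_diff_right)
      also have "\<dots> \<le> L * E s * ?d"
        using L E(1)[of s] dist_bounded[of \<phi> s \<psi>] by (simp add: dist_norm mult.assoc)
      finally show "norm (F s (E s *\<^sub>R apply_bcontfun \<phi> s) - F s (E s *\<^sub>R apply_bcontfun \<psi> s))
          \<le> L * E s * ?d" .
    qed (use E_int inth'[OF r] in \<open>auto intro: integrable_diff\<close>)
    also have "\<dots> \<le> E r * (1 / 2 * ?d)"
      using integral_unique[OF E_int] E(1)[of a] by simp
    finally have "norm (h (apply_bcontfun \<phi>) r - h (apply_bcontfun \<psi>) r) / E r \<le> 1 / 2 * ?d"
      using E(1)[of r] by (simp add: pos_divide_le_eq mult.commute)
    moreover have "apply_bcontfun (Z \<phi>) t - apply_bcontfun (Z \<psi>) t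
        = (1 / E r) *\<^sub>R (h (apply_bcontfun \<phi>) r - h (apply_bcontfun \<psi>) r)"
      by (simp only: Z r_def scaleR_diff_right)
    ultimately show "dist (apply_bcontfun (Z \<phi>) t) (apply_bcontfun (Z \<psi>) t) \<le> 1 / 2 * ?d"
      using E(1)[of r] by (simp add: dist_norm)
  qed
  then obtain \<phi> where \<phi>: "Z \<phi> = \<phi>"
    using banach_fix_type[of "1 / 2" Z] by auto
  define x where "x t = E t *\<^sub>R apply_bcontfun \<phi> t" for t
  have x: "x t = x0 + integral {a..t} (\<lambda>s. F s (x s))" if "t \<in> {a..b}" for t
    using Z[of \<phi> t] m(2)[OF that] E(1)[of t] unfolding \<phi> by (simp add: x_def h_def)
  have "x a = x0" using x[of a] ab by simp
  moreover have "solves_ode F x a b"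
    unfolding solves_ode_def
  proof
    fix t assume t: "t \<in> {a..b}"
    have "(\<lambda>s. F s (x s)) integrable_on {a..t}"
      using inth'[OF t, of \<phi>] by (simp add: x_def)
    then show "((\<lambda>s. F s (x s)) has_integral (x t - x a)) {a..t}"
      using x[OF t] \<open>x a = x0\<close> by (simp add: has_integral_iff)
  qed
  ultimately show ?thesis by blast
qed

text \<open>The integrand is bounded, and continuous off a finite set.\<close>

lemma integrable_controlled_vector_field:
  fixes f :: "'a::euclidean_space \<Rightarrow> 'b::euclidean_space \<Rightarrow> 'c::euclidean_space"
  assumes f: "continuous_on UNIV (\<lambda>(y, v). f y v)"
    and U: "compact U" "\<And>s. s \<in> {a..b} \<Longrightarrow> u s \<in> U"
    and u: "piecewise_right_continuous a b u"
    and y: "continuous_on {a..b} y"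
  shows "(\<lambda>s. f (y s) (u s)) integrable_on {a..b}"
proof -
  let ?g = "\<lambda>s. f (y s) (u s)"
  obtain D where D: "finite D" "\<forall>t\<in>{a..b} - D. continuous (at t within {a..b}) u"
    using u by (auto simp: piecewise_right_continuous_def)
  have "compact ((\<lambda>(y, v). f y v) ` (y ` {a..b} \<times> U))"
    using f y U(1) by (intro compact_continuous_image compact_Times) (auto elim: continuous_on_subset)
  then obtain C where C: "\<And>z. z \<in> (\<lambda>(y, v). f y v) ` (y ` {a..b} \<times> U) \<Longrightarrow> norm z \<le> C"
    by (meson compact_imp_bounded bounded_iff)
  have neg: "negligible D" using D(1) by (rule negligible_finite)
  have "continuous_on ({a..b} - D) u"
    using D(2) by (auto simp: continuous_on_eq_continuous_within intro: continuous_within_subset)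
  then have "continuous_on ({a..b} - D) (\<lambda>s. (\<lambda>(y, v). f y v) (y s, u s))"
    using y by (intro continuous_on_compose2[OF f] continuous_on_Pair)
      (auto elim: continuous_on_subset)
  moreover have D_sets: "{a..b} - D \<in> sets lebesgue"
    using negligible_imp_sets[OF neg] by (intro sets.Diff) auto
  ultimately have meas: "?g \<in> borel_measurable (lebesgue_on ({a..b} - D))"
    using continuous_imp_measurable_on_sets_lebesgue by fastforce
  have spike: "negligible {s \<in> A - B. g s \<noteq> (0::'c)}" "negligible {s \<in> A - B. k s \<noteq> (0::real)}"
    if "A - B \<subseteq> D" for A B g k
    using that by (blast intro: negligible_subset[OF neg])+
  have "(\<lambda>_. C) integrable_on ({a..b} - D)"
    by (rule integrable_spike_set[OF integrable_const_ivl[of C a b]]; rule spike) blast+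
  moreover have "norm (?g s) \<le> C" if "s \<in> {a..b} - D" for s
    using that U(2) by (intro C) (force intro!: rev_image_eqI[of "(y s, u s)"])
  ultimately have "?g integrable_on ({a..b} - D)"
    by (rule measurable_bounded_by_integrable_imp_integrable[OF meas _ _ D_sets])
  then show ?thesis
    by (rule integrable_spike_set; intro spike) blast+
qed

section \<open>The weighted norm and trajectories under the terminal feedback\<close>

lemma wnorm_nonneg: "pos_def P \<Longrightarrow> 0 \<le> wnorm P x"
  by (simp add: wnorm_def pos_def_nonneg)

lemma wnorm_power2: "pos_def P \<Longrightarrow> (wnorm P x)\<^sup>2 = x \<bullet> (P *v x)"
  by (simp add: wnorm_def pos_def_nonneg)

lemma wnorm_scaleR: "wnorm P (c *\<^sub>R x) = \<bar>c\<bar> * wnorm P x"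
  by (simp add: wnorm_def matrix_vector_mult_scaleR real_sqrt_mult power2_eq_square[symmetric]
      mult.assoc[symmetric])

lemma wnorm_triangle: "pos_def P \<Longrightarrow> wnorm P (x + y) \<le> wnorm P x + wnorm P y"
  by (simp add: wnorm_eq_norm_sqrt matrix_vector_right_distrib norm_triangle_ineq)

lemma wnorm_minus_commute: "pos_def P \<Longrightarrow> wnorm P (x - y) = wnorm P (y - x)"
  by (simp add: wnorm_eq_norm_sqrt matrix_vector_mult_diff_distrib norm_minus_commute)

lemma continuous_on_wnorm [continuous_intros]:
  assumes "pos_def P" "continuous_on X g"
  shows "continuous_on X (\<lambda>s. wnorm P (g s))"
  unfolding wnorm_eq_norm_sqrt[OF assms(1)]
  by (intro continuous_intros assms(2) bounded_linear.continuous_on[OF matrix_vector_mul_bounded_linear])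

lemma wnorm_le_norm: "pos_def P \<Longrightarrow> wnorm P x \<le> lambda_max (matrix_sqrt P) * norm x"
  by (simp add: wnorm_eq_norm_sqrt matrix_sqrt_pos_def pos_def_norm_mult_le)

lemma norm_le_wnorm:
  assumes "pos_def P"
  shows "sqrt (lambda_min P) * norm x \<le> wnorm P x"
proof -
  have "sqrt (lambda_min P) * norm x = sqrt (lambda_min P * (norm x)\<^sup>2)"
    by (simp add: real_sqrt_mult)
  also have "\<dots> \<le> sqrt (x \<bullet> (P *v x))"
    using assms by (intro real_sqrt_le_mono symmetric_quadratic_form_bounds) (simp add: pos_def_def)
  finally show ?thesis by (simp add: wnorm_def)
qed

lemma wnorm_ratio_bound:
  assumes "pos_def P" "pos_def Q"
  shows "lambda_min Q / lambda_max P * (wnorm P x)\<^sup>2 \<le> (wnorm Q x)\<^sup>2"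
proof -
  have "lambda_min Q / lambda_max P * (wnorm P x)\<^sup>2
      \<le> lambda_min Q / lambda_max P * (lambda_max P * (norm x)\<^sup>2)"
  proof (rule mult_left_mono)
    show "(wnorm P x)\<^sup>2 \<le> lambda_max P * (norm x)\<^sup>2"
      using assms(1) symmetric_quadratic_form_bounds(1)[of P x]
      by (auto simp: wnorm_power2 pos_def_def)
    show "0 \<le> lambda_min Q / lambda_max P"
      using pos_def_lambda_pos(1)[OF assms(2)] pos_def_lambda_pos(2)[OF assms(1)] by simp
  qed
  also have "\<dots> = lambda_min Q * (norm x)\<^sup>2"
    using pos_def_lambda_pos(2)[OF assms(1)] by simp
  also have "\<dots> \<le> (wnorm Q x)\<^sup>2"
    using assms symmetric_quadratic_form_bounds(2)[of Q x] by (auto simp: wnorm_power2 pos_def_def)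
  finally show ?thesis .
qed

lemma convex_sublevel:
  assumes "pos_def P"
  shows "convex (sublevel P r)"
proof -
  have "sublevel P r = (\<lambda>x. matrix_sqrt P *v x) -` cball 0 r"
    using assms by (auto simp: sublevel_def wnorm_eq_norm_sqrt)
  then show ?thesis by (simp add: convex_linear_vimage matrix_vector_mul_linear)
qed

lemma compact_sublevel:
  assumes "pos_def P"
  shows "compact (sublevel P r)"
proof -
  have "norm x \<le> r / sqrt (lambda_min P)" if "wnorm P x \<le> r" for x
    using that norm_le_wnorm[OF assms, of x] pos_def_lambda_pos(1)[OF assms]
    by (simp add: pos_le_divide_eq mult.commute)
  then have "bounded (sublevel P r)" by (auto simp: sublevel_def bounded_iff)
  moreover have "closed (sublevel P r)"
    unfolding sublevel_def by (intro closed_Collect_le continuous_intros assms)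
  ultimately show ?thesis by (simp add: compact_eq_bounded_closed)
qed

lemma has_derivative_wnorm_power2:
  assumes "pos_def P"
  shows "((\<lambda>z. (wnorm P z)\<^sup>2) has_derivative (\<lambda>d. 2 * (y \<bullet> (P *v d)))) (at y)"
proof -
  have sym: "transpose P = P" using assms by (simp add: pos_def_def)
  have "((\<lambda>z. z \<bullet> (P *v z)) has_derivative (\<lambda>d. y \<bullet> (P *v d) + d \<bullet> (P *v y))) (at y)"
    by (intro has_derivative_inner has_derivative_ident
        bounded_linear.has_derivative[OF matrix_vector_mul_bounded_linear])
  moreover have "y \<bullet> (P *v d) + d \<bullet> (P *v y) = 2 * (y \<bullet> (P *v d))" for d
    using symmetric_inner_swap[OF sym, of d y] by (simp add: inner_commute)
  ultimately show ?thesis by (simp add: wnorm_power2[OF assms])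
qed

lemma has_real_derivative_wnorm_power2:
  assumes "pos_def P" "(y has_vector_derivative d) (at s within A)"
  shows "((\<lambda>s. (wnorm P (y s))\<^sup>2) has_real_derivative 2 * (y s \<bullet> (P *v d))) (at s within A)"
proof -
  have "((\<lambda>s. (wnorm P (y s))\<^sup>2) has_derivative (\<lambda>h. 2 * (y s \<bullet> (P *v (h *\<^sub>R d))))) (at s within A)"
    using has_derivative_compose[OF assms(2)[unfolded has_vector_derivative_def]
        has_derivative_wnorm_power2[OF assms(1)]] .
  moreover have "(\<lambda>h. 2 * (y s \<bullet> (P *v (h *\<^sub>R d)))) = (*) (2 * (y s \<bullet> (P *v d)))"
    by (simp add: fun_eq_iff matrix_vector_mult_scaleR)
  ultimately show ?thesis by (simp add: has_field_derivative_def)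
qed

text \<open>With \<open>\<mu> = 0\<close> this says that \<open>V\<close> is nonincreasing.\<close>

lemma exponential_decay:
  fixes V :: "real \<Rightarrow> real"
  assumes V: "\<And>s. s \<in> {a..b} \<Longrightarrow> (V has_real_derivative V' s) (at s within {a..b})"
    and le: "\<And>s. s \<in> {a..b} \<Longrightarrow> V' s \<le> - \<mu> * V s" and t: "t \<in> {a..b}"
  shows "V t \<le> V a * exp (- \<mu> * (t - a))"
proof -
  define D where "D s = V s * exp (\<mu> * (s - a))" for s
  have "D t \<le> D a"
  proof (rule DERIV_nonpos_imp_decreasing_open[where f = D and a = a and b = t])
    show "a \<le> t" using t by simp
    have "continuous_on {a..b} V" by (rule DERIV_continuous_on[OF V])
    then show "continuous_on {a..t} D"
      unfolding D_def using t by (intro continuous_intros) (auto elim: continuous_on_subset)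
    fix s assume s: "a < s" "s < t"
    have "(V has_real_derivative V' s) (at s)"
      using V[of s] s t by (simp add: at_within_Icc_at)
    then have "(D has_real_derivative
        V' s * exp (\<mu> * (s - a)) + V s * (exp (\<mu> * (s - a)) * \<mu>)) (at s)"
      unfolding D_def by (auto intro!: derivative_eq_intros)
    moreover have "V' s * exp (\<mu> * (s - a)) + V s * (exp (\<mu> * (s - a)) * \<mu>)
        = (V' s + \<mu> * V s) * exp (\<mu> * (s - a))"
      by (simp add: algebra_simps)
    moreover have "V' s + \<mu> * V s \<le> 0" using le[of s] s t by simp
    ultimately show "\<exists>y. (D has_real_derivative y) (at s) \<and> y \<le> 0"
      by (metis exp_ge_zero mult_nonpos_nonneg)
  qed
  then have "V t * exp (\<mu> * (t - a)) * exp (- \<mu> * (t - a)) \<le> V a * exp (- \<mu> * (t - a))"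
    by (intro mult_right_mono) (auto simp: D_def)
  then show ?thesis by (simp add: mult.assoc exp_add[symmetric])
qed

lemma twice_continuously_differentiable_lipschitz:
  fixes F :: "'a::real_normed_vector \<Rightarrow> 'b::real_normed_vector"
  assumes "twice_continuously_differentiable F" "compact X" "convex X"
  shows "\<exists>C. C-lipschitz_on X F"
proof -
  obtain F' :: "'a \<Rightarrow> 'a \<Rightarrow>\<^sub>L 'b" and F'' :: "'a \<Rightarrow> 'a \<Rightarrow>\<^sub>L 'a \<Rightarrow>\<^sub>L 'b"
    where F': "\<And>z. (F has_derivative blinfun_apply (F' z)) (at z)"
      "\<And>z. (F' has_derivative blinfun_apply (F'' z)) (at z)"
    using assms(1) by (auto simp: twice_continuously_differentiable_def)
  have "continuous_on X F'"
    using F'(2) by (intro continuous_at_imp_continuous_on) (auto dest: has_derivative_continuous)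
  then have "bounded (F' ` X)"
    using assms(2) by (intro compact_imp_bounded compact_continuous_image)
  then obtain C where C: "C > 0" "\<And>z. z \<in> X \<Longrightarrow> norm (F' z) \<le> C"
    by (auto simp: bounded_pos)
  have "norm (F y - F z) \<le> C * norm (y - z)" if "y \<in> X" "z \<in> X" for y z
    using C that
    by (intro differentiable_bound[OF assms(3) has_derivative_at_withinI[OF F'(1)]])
      (auto simp: norm_blinfun.rep_eq[symmetric])
  then have "C-lipschitz_on X F"
    using C(1) by (intro lipschitz_onI) (auto simp: dist_norm)
  then show ?thesis ..
qed

lemma twice_continuously_differentiable_continuous:
  assumes "twice_continuously_differentiable F"
  shows "continuous_on UNIV F"
  using assms unfolding twice_continuously_differentiable_def
  by (metis continuous_at_imp_continuous_on has_derivative_continuous)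

text \<open>Only local smoothness is available here: \<open>K y\<close> varies with \<open>y\<close>, while the global Lipschitz
  condition on \<open>f\<close> concerns the state for a fixed control.\<close>

lemma lipschitz_closed_loop_field:
  fixes f :: "real^'n \<Rightarrow> real^'m \<Rightarrow> real^'n" and K :: "real^'n^'m"
  assumes f: "twice_continuously_differentiable (\<lambda>(y, v). f y v)"
    and X: "compact X" "convex X"
  shows "\<exists>C. C-lipschitz_on X (\<lambda>y. f y (K *v y))"
proof -
  let ?J = "\<lambda>y. (y, K *v y)"
  have J: "bounded_linear ?J"
    by (intro bounded_linear_Pair bounded_linear_ident matrix_vector_mul_bounded_linear)
  obtain C' where "C'-lipschitz_on (?J ` X) (\<lambda>(y, v). f y v)"
    using twice_continuously_differentiable_lipschitz[OF f, of "?J ` X"] X J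
    by (auto intro: compact_continuous_image linear_continuous_on convex_linear_image
        bounded_linear.linear)
  moreover obtain C where "C-lipschitz_on X ?J"
    using bounded_linear.lipschitz_boundE[OF J] by blast
  ultimately have "(C' * C)-lipschitz_on X (\<lambda>y. (\<lambda>(y, v). f y v) (?J y))"
    by (intro lipschitz_on_compose2)
  then show ?thesis by auto
qed

definition radial_retraction :: "real^'n^'n \<Rightarrow> real \<Rightarrow> real^'n \<Rightarrow> real^'n" where
  "radial_retraction P r y = (r / max r (wnorm P y)) *\<^sub>R y"

lemma radial_retraction_in_sublevel:
  assumes "pos_def P" "0 < r"
  shows "radial_retraction P r y \<in> sublevel P r"
proof -
  have "r / max r (wnorm P y) * wnorm P y \<le> r"
    using assms(2) wnorm_nonneg[OF assms(1), of y]
    by (simp add: pos_divide_le_eq max_def)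
  then show ?thesis
    using assms(2) by (simp add: sublevel_def radial_retraction_def wnorm_scaleR)
qed

lemma radial_retraction_id:
  "y \<in> sublevel P r \<Longrightarrow> 0 < r \<Longrightarrow> radial_retraction P r y = y"
  by (simp add: radial_retraction_def sublevel_def max_def)

text \<open>The displacement splits into a part along \<open>y - z\<close> and a part due to the different scaling factors,
  each at most \<open>wnorm P (y - z)\<close>; for the second, the denominators differ by no more than the norms do.\<close>

lemma radial_retraction_lipschitz:
  assumes P: "pos_def P" and r: "0 < r"
  shows "wnorm P (radial_retraction P r y - radial_retraction P r z) \<le> 2 * wnorm P (y - z)"
proof -
  let ?N = "wnorm P"
  define my mz where "my = max r (?N y)" and "mz = max r (?N z)"
  have m: "0 < my" "0 < mz" "r \<le> my" "?N z \<le> mz" using r by (auto simp: my_def mz_def)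
  have "?N y \<le> ?N (y - z) + ?N z" "?N z \<le> ?N (z - y) + ?N y"
    using wnorm_triangle[OF P, of "y - z" z] wnorm_triangle[OF P, of "z - y" y] by simp_all
  then have diff: "\<bar>mz - my\<bar> \<le> ?N (y - z)"
    using wnorm_minus_commute[OF P, of y z] wnorm_nonneg[OF P, of "y - z"] by (auto simp: my_def mz_def)
  have "radial_retraction P r y - radial_retraction P r z
      = (r / my) *\<^sub>R (y - z) + (r / my - r / mz) *\<^sub>R z"
    by (simp add: radial_retraction_def my_def mz_def algebra_simps)
  then have "?N (radial_retraction P r y - radial_retraction P r z)
      \<le> \<bar>r / my\<bar> * ?N (y - z) + \<bar>r / my - r / mz\<bar> * ?N z"
    using wnorm_triangle[OF P] by (metis wnorm_scaleR)
  also have "\<bar>r / my\<bar> * ?N (y - z) \<le> 1 * ?N (y - z)"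
    using m r wnorm_nonneg[OF P] by (intro mult_right_mono) auto
  also have "\<bar>r / my - r / mz\<bar> * ?N z \<le> ?N (y - z)"
  proof -
    have "r / my - r / mz = (r / my) * ((mz - my) / mz)"
      using m by (simp add: field_simps)
    then have "\<bar>r / my - r / mz\<bar> * ?N z = (r / my) * (\<bar>mz - my\<bar> * (?N z / mz))"
      using m r by (simp add: abs_mult)
    also have "\<dots> \<le> 1 * (\<bar>mz - my\<bar> * 1)"
      using m r wnorm_nonneg[OF P, of z] by (intro mult_mono) auto
    finally show ?thesis using diff by simp
  qed
  finally show ?thesis by simp
qed

lemma solves_ode_has_vector_derivative:
  assumes "solves_ode (\<lambda>_. h) y a b" "continuous_on UNIV h" "s \<in> {a..b}"
  shows "(y has_vector_derivative h (y s)) (at s within {a..b})"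
proof -
  have hi: "((\<lambda>s. h (y s)) has_integral (y t - y a)) {a..t}" if "t \<in> {a..b}" for t
    using assms(1) that by (simp add: solves_ode_def)
  have "continuous_on {a..b} (\<lambda>s. h (y s))"
    using continuous_on_compose2[OF assms(2) solves_ode_continuous[OF assms(1)]] by simp
  from integral_has_vector_derivative[OF this assms(3)]
  have "((\<lambda>t. y a + integral {a..t} (\<lambda>s. h (y s))) has_vector_derivative h (y s)) (at s within {a..b})"
    by (auto intro!: derivative_eq_intros)
  then show ?thesis
    using assms(3) integral_unique[OF hi]
    by (elim has_vector_derivative_transform[rotated 2]) auto
qed

text \<open>The field \<open>g\<close> is Lipschitz on the sublevel set only, so the equation is solved for the globally
  Lipschitz field \<open>g \<circ> \<pi>\<close>, where \<open>\<pi>\<close> is the radial retraction onto that set. As \<open>\<pi> y\<close> is a positive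
  multiple of \<open>y\<close>, the decrease condition makes \<open>wnorm P\<close> nonincreasing along this solution everywhere, so
  it never leaves the set, where \<open>\<pi>\<close> is the identity and the decrease becomes exponential.\<close>

lemma terminal_trajectory:
  fixes g :: "real^'n \<Rightarrow> real^'n"
  assumes P: "pos_def P" and Q: "pos_def Q" and \<epsilon>: "0 < \<epsilon>" and ab: "a \<le> b"
    and lip: "C-lipschitz_on (sublevel P \<epsilon>) g"
    and decrease: "\<And>y. y \<in> sublevel P \<epsilon> \<Longrightarrow> 2 * (y \<bullet> (P *v g y)) \<le> - (wnorm Q y)\<^sup>2"
    and y0: "y0 \<in> sublevel P \<epsilon>"
  shows "\<exists>y. y a = y0 \<and> solves_ode (\<lambda>_. g) y a b \<and>
    (\<forall>s\<in>{a..b}. wnorm P (y s) \<le> \<epsilon> * exp (- (lambda_min Q / lambda_max P / 2) * (s - a)))"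
proof -
  define \<pi> where "\<pi> = radial_retraction P \<epsilon>"
  define h where "h y = g (\<pi> y)" for y
  define c where "c = sqrt (lambda_min P)"
  define \<mu> where "\<mu> = lambda_min Q / lambda_max P"
  have c: "0 < c" using pos_def_lambda_pos(1)[OF P] by (simp add: c_def)
  have \<mu>: "0 < \<mu>" using pos_def_lambda_pos(1)[OF Q] pos_def_lambda_pos(2)[OF P] by (simp add: \<mu>_def)
  have \<pi>: "\<pi> y \<in> sublevel P \<epsilon>" for y
    using radial_retraction_in_sublevel[OF P \<epsilon>] by (simp add: \<pi>_def)
  have C: "0 \<le> C" using lip by (rule lipschitz_on_nonneg)
  define \<Lambda> where "\<Lambda> = C * (2 * lambda_max (matrix_sqrt P) / c) + 1"
  have \<Lambda>: "0 < \<Lambda>"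
    using C c pos_def_lambda_pos(2)[OF matrix_sqrt_pos_def(1)[OF P]]
    by (auto simp: \<Lambda>_def intro!: add_nonneg_pos mult_nonneg_nonneg)
  have h_lip: "norm (h y - h z) \<le> \<Lambda> * norm (y - z)" for y z
  proof -
    have "c * norm (\<pi> y - \<pi> z) \<le> wnorm P (\<pi> y - \<pi> z)"
      unfolding c_def by (rule norm_le_wnorm[OF P])
    also have "\<dots> \<le> 2 * wnorm P (y - z)"
      unfolding \<pi>_def by (rule radial_retraction_lipschitz[OF P \<epsilon>])
    also have "\<dots> \<le> 2 * (lambda_max (matrix_sqrt P) * norm (y - z))"
      using wnorm_le_norm[OF P] by simp
    finally have "norm (\<pi> y - \<pi> z) \<le> 2 * lambda_max (matrix_sqrt P) / c * norm (y - z)"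
      using c by (simp add: field_simps)
    then have "C * norm (\<pi> y - \<pi> z) \<le> C * (2 * lambda_max (matrix_sqrt P) / c * norm (y - z))"
      using C by (rule mult_left_mono)
    moreover have "norm (h y - h z) \<le> C * norm (\<pi> y - \<pi> z)"
      using lipschitz_onD[OF lip \<pi> \<pi>] by (simp add: h_def dist_norm)
    ultimately show ?thesis by (simp add: \<Lambda>_def algebra_simps add_increasing)
  qed
  have h_cont: "continuous_on UNIV h"
    using h_lip \<Lambda> by (intro lipschitz_on_continuous_on[of \<Lambda>] lipschitz_onI) (auto simp: dist_norm)
  obtain y where y: "y a = y0" "solves_ode (\<lambda>_. h) y a b"
    using solves_ode_exists[OF ab \<Lambda>, of "\<lambda>_. h" y0] h_lip
      integrable_continuous_interval[OF continuous_on_compose2[OF h_cont]] by blast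
  let ?V = "\<lambda>s. (wnorm P (y s))\<^sup>2"
  let ?V' = "\<lambda>s. 2 * (y s \<bullet> (P *v h (y s)))"
  have V: "(?V has_real_derivative ?V' s) (at s within {a..b})" if "s \<in> {a..b}" for s
    by (rule has_real_derivative_wnorm_power2[OF P solves_ode_has_vector_derivative[OF y(2) h_cont that]])
  \<comment> \<open>Scaling by \<open>q > 0\<close> turns this derivative into the one that the decrease condition controls at \<open>\<pi> (y s)\<close>.\<close>
  have V'_nonpos: "?V' s \<le> 0" for s
  proof -
    define q where "q = \<epsilon> / max \<epsilon> (wnorm P (y s))"
    have q: "0 < q" using \<epsilon> by (simp add: q_def max_def)
    have "\<pi> (y s) = q *\<^sub>R y s" by (simp add: \<pi>_def radial_retraction_def q_def)
    then have "q * ?V' s = 2 * (\<pi> (y s) \<bullet> (P *v g (\<pi> (y s))))" by (simp add: h_def)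
    also have "\<dots> \<le> 0" using decrease[OF \<pi>[of "y s"]] zero_le_power2[of "wnorm Q (\<pi> (y s))"] by linarith
    finally show ?thesis using q by (simp add: mult_le_0_iff)
  qed
  have V_le: "?V s \<le> \<epsilon>\<^sup>2" if "s \<in> {a..b}" for s
  proof -
    have "?V s \<le> ?V a" using exponential_decay[OF V, of 0 s] V'_nonpos that by simp
    also have "\<dots> \<le> \<epsilon>\<^sup>2"
      using y0 y(1) wnorm_nonneg[OF P] by (auto simp: sublevel_def intro: power_mono)
    finally show ?thesis .
  qed
  have y_in: "y s \<in> sublevel P \<epsilon>" if "s \<in> {a..b}" for s
    using power2_le_imp_le[OF V_le[OF that]] \<epsilon> by (simp add: sublevel_def)
  have hg: "h (y s) = g (y s)" if "s \<in> {a..b}" for s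
    using radial_retraction_id[OF y_in[OF that] \<epsilon>] by (simp add: h_def \<pi>_def)
  have decay: "wnorm P (y s) \<le> \<epsilon> * exp (- (\<mu> / 2) * (s - a))" if s: "s \<in> {a..b}" for s
  proof -
    have "?V' r \<le> - \<mu> * ?V r" if "r \<in> {a..b}" for r
      using decrease[OF y_in[OF that]] hg[OF that] wnorm_ratio_bound[OF P Q, of "y r"]
      by (simp add: \<mu>_def)
    from exponential_decay[OF V this s] have "?V s \<le> ?V a * exp (- \<mu> * (s - a))" by simp
    also have "\<dots> \<le> \<epsilon>\<^sup>2 * exp (- \<mu> * (s - a))"
      using V_le[of a] ab by (intro mult_right_mono) auto
    also have "\<dots> = (\<epsilon> * exp (- (\<mu> / 2) * (s - a)))\<^sup>2"
      by (simp add: power_mult_distrib exp_double[symmetric])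
    finally show ?thesis by (rule power2_le_imp_le) (use \<epsilon> in auto)
  qed
  have "solves_ode (\<lambda>_. g) y a b"
    by (rule solves_ode_cong_finite[OF y(2) finite.emptyI refl]) (simp add: hg)
  with y(1) decay show ?thesis by (auto simp: \<mu>_def)
qed

section \<open>Concatenation of piecewise continuous controls\<close>

text \<open>Limits see a function and a domain only near the point; this covers all joins of two controls below.\<close>

lemma tendsto_within_local:
  fixes f g :: "'a::metric_space \<Rightarrow> 'b::topological_space"
  assumes "(f \<longlongrightarrow> l) (at t within A)" "0 < d"
    and "\<And>s. s \<in> B \<Longrightarrow> s \<noteq> t \<Longrightarrow> dist s t < d \<Longrightarrow> s \<in> A \<and> f s = g s"
  shows "(g \<longlongrightarrow> l) (at t within B)"
proof (rule topological_tendstoI)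
  fix S assume "open S" "l \<in> S"
  then have "eventually (\<lambda>s. f s \<in> S) (at t within A)"
    using assms(1) by (rule topological_tendstoD[rotated])
  then obtain e where e: "e > 0" "\<And>s. s \<in> A \<Longrightarrow> s \<noteq> t \<Longrightarrow> dist s t < e \<Longrightarrow> f s \<in> S"
    unfolding eventually_at by blast
  have "g s \<in> S" if "s \<in> B" "s \<noteq> t" "dist s t < min d e" for s
  proof -
    have "s \<in> A" "f s = g s" using assms(3)[of s] that by auto
    then show ?thesis using e(2)[of s] that by simp
  qed
  then show "eventually (\<lambda>s. g s \<in> S) (at t within B)"
    unfolding eventually_at using e(1) assms(2) by (intro exI[of _ "min d e"]) auto
qed

lemma piecewise_right_continuous_tail:
  assumes u: "piecewise_right_continuous a b u" and c: "a \<le> c"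
  shows "piecewise_right_continuous c b u"
proof -
  obtain D where D: "finite D" "\<forall>t\<in>{a..b} - D. continuous (at t within {a..b}) u"
    using u by (auto simp: piecewise_right_continuous_def)
  have "\<forall>t\<in>{c..b} - D. continuous (at t within {c..b}) u"
  proof
    fix t assume "t \<in> {c..b} - D"
    then have "continuous (at t within {a..b}) u" using D(2) c by auto
    then show "continuous (at t within {c..b}) u"
      by (rule continuous_within_subset) (use c in auto)
  qed
  moreover have "\<exists>l. (u \<longlongrightarrow> l) (at t within {c..<t})" if "t \<in> {c<..b}" for t
  proof -
    have "t \<in> {a<..b}" using that c by auto
    then obtain l where "(u \<longlongrightarrow> l) (at t within {a..<t})"
      using u unfolding piecewise_right_continuous_def by blast
    then have "(u \<longlongrightarrow> l) (at t within {c..<t})"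
      by (rule tendsto_within_subset) (use c in auto)
    then show ?thesis ..
  qed
  ultimately show ?thesis
    using u D(1) c unfolding piecewise_right_continuous_def by auto
qed

text \<open>At the joining point \<open>c\<close> the second control is used, as continuity from the right requires; the point
  itself joins the finite set of possible discontinuities.\<close>

lemma piecewise_right_continuous_append:
  fixes u v :: "real \<Rightarrow> 'a::topological_space"
  assumes u: "piecewise_right_continuous a c u" and v: "continuous_on {c..b} v"
    and ac: "a \<le> c" and cb: "c \<le> b"
  shows "piecewise_right_continuous a b (\<lambda>s. if s < c then u s else v s)"
    (is "piecewise_right_continuous a b ?u")
proof -
  obtain D where D: "finite D" "\<forall>t\<in>{a..c} - D. continuous (at t within {a..c}) u"
    using u by (auto simp: piecewise_right_continuous_def)
  have v_lim: "(v \<longlongrightarrow> v t) (at t within {c..b})" if "t \<in> {c..b}" for t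
    using v that by (simp add: continuous_on)
  have before: "(?u \<longlongrightarrow> ?u t) (at t within {a..b})" if t: "t \<in> {a..b} - D" "t < c" for t
  proof (rule tendsto_within_local)
    show "(u \<longlongrightarrow> ?u t) (at t within {a..c})" using D(2) t by (auto simp: continuous_within)
    show "0 < c - t" using t by simp
  qed (auto simp: dist_real_def)
  have after: "(?u \<longlongrightarrow> ?u t) (at t within {a..b})" if t: "t \<in> {a..b}" "c < t" for t
  proof (rule tendsto_within_local)
    show "(v \<longlongrightarrow> ?u t) (at t within {c..b})" using v_lim[of t] t by simp
    show "0 < t - c" using t by simp
  qed (auto simp: dist_real_def)
  have "\<forall>t\<in>{a..b} - insert c D. continuous (at t within {a..b}) ?u"
  proof
    fix t assume t: "t \<in> {a..b} - insert c D"
    show "continuous (at t within {a..b}) ?u"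
      unfolding continuous_within using before[of t] after[of t] t
      by (cases "t < c") auto
  qed
  moreover have "\<forall>t\<in>{a..<b}. continuous (at t within {t..b}) ?u"
  proof
    fix t assume t: "t \<in> {a..<b}"
    show "continuous (at t within {t..b}) ?u"
    proof (cases "t < c")
      case True
      have "(?u \<longlongrightarrow> ?u t) (at t within {t..b})"
      proof (rule tendsto_within_local)
        have "continuous (at t within {t..c}) u"
          using u t True by (auto simp: piecewise_right_continuous_def)
        then show "(u \<longlongrightarrow> ?u t) (at t within {t..c})" using True by (simp add: continuous_within)
        show "0 < c - t" using True by simp
      qed (auto simp: dist_real_def)
      then show ?thesis by (simp add: continuous_within)
    next
      case False
      have "(?u \<longlongrightarrow> ?u t) (at t within {t..b})"
      proof (rule tendsto_within_local)
        show "(v \<longlongrightarrow> ?u t) (at t within {c..b})" using v_lim[of t] t False by simp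
        show "(0::real) < 1" by simp
      qed (use False in auto)
      then show ?thesis by (simp add: continuous_within)
    qed
  qed
  moreover have "\<forall>t\<in>{a<..b}. \<exists>l. (?u \<longlongrightarrow> l) (at t within {a..<t})"
  proof
    fix t assume t: "t \<in> {a<..b}"
    show "\<exists>l. (?u \<longlongrightarrow> l) (at t within {a..<t})"
    proof (cases "t \<le> c")
      case True
      then have "t \<in> {a<..c}" using t by auto
      then obtain l where l: "(u \<longlongrightarrow> l) (at t within {a..<t})"
        using u unfolding piecewise_right_continuous_def by blast
      have "(?u \<longlongrightarrow> l) (at t within {a..<t})"
        by (rule tendsto_within_local[OF l zero_less_one]) (use True in auto)
      then show ?thesis ..
    next
      case False
      then have "(?u \<longlongrightarrow> ?u t) (at t within {a..b})" using after[of t] t by simp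
      then have "(?u \<longlongrightarrow> ?u t) (at t within {a..<t})"
        by (rule tendsto_within_subset) (use t in auto)
      then show ?thesis ..
    qed
  qed
  ultimately show ?thesis
    unfolding piecewise_right_continuous_def using D(1) by blast
qed


section \<open>Prediction error and triggering time\<close>

text \<open>The closed form of \<open>\<integral>\<^sub>0\<^sup>r s e\<^sup>L\<^sup>s ds\<close>.\<close>

definition error_bound :: "real \<Rightarrow> real \<Rightarrow> real" where
  "error_bound L r = exp (L * r) * (r / L - 1 / L\<^sup>2) + 1 / L\<^sup>2"

lemma error_bound_0 [simp]: "error_bound L 0 = 0"
  by (simp add: error_bound_def)

lemma error_bound_has_derivative:
  assumes "L \<noteq> 0"
  shows "(error_bound L has_real_derivative r * exp (L * r)) (at r)"
proof -
  have "(error_bound L has_real_derivative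
      exp (L * r) * L * (r / L - 1 / L\<^sup>2) + exp (L * r) * (1 / L)) (at r)"
    unfolding error_bound_def[abs_def] using assms by (auto intro!: derivative_eq_intros)
  moreover have "exp (L * r) * L * (r / L - 1 / L\<^sup>2) + exp (L * r) * (1 / L) = r * exp (L * r)"
    using assms by (simp add: field_simps power2_eq_square)
  ultimately show ?thesis by simp
qed

lemma error_bound_strict_mono:
  assumes "L \<noteq> 0" "0 \<le> r" "r < q"
  shows "error_bound L r < error_bound L q"
proof (rule DERIV_pos_imp_increasing_open[OF assms(3)])
  fix s assume "r < s" "s < q"
  then have "s * exp (L * s) > 0" using assms(2) by simp
  then show "\<exists>y. (error_bound L has_real_derivative y) (at s) \<and> 0 < y"
    using error_bound_has_derivative[OF assms(1)] by blast
next
  show "continuous_on {r..q} (error_bound L)"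
    by (rule DERIV_continuous_on[OF has_field_derivative_at_within[OF
          error_bound_has_derivative[OF assms(1)]]])
qed

text \<open>\<open>error_bound\<close> is a supersolution of \<open>\<Phi>' = r + L \<Phi>\<close>, because \<open>1 + L r \<le> exp (L r)\<close>.\<close>

lemma integrated_error_le:
  fixes \<phi> :: "real \<Rightarrow> real"
  assumes cont: "continuous_on {a..b} \<phi>" and L: "0 < L" and p: "0 \<le> p"
    and le: "\<And>s. s \<in> {a..b} \<Longrightarrow> \<phi> s \<le> p * (s - a) + L * integral {a..s} \<phi>"
    and t: "t \<in> {a..b}"
  shows "integral {a..t} \<phi> \<le> p * error_bound L (t - a)"
proof (rule integral_inequality_comparison[OF cont le _ _ _ t])
  fix s
  have "((\<lambda>s. error_bound L (s - a)) has_real_derivative (s - a) * exp (L * (s - a)) * 1) (at s)"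
    by (rule DERIV_chain2[OF error_bound_has_derivative])
      (use L in \<open>auto intro!: derivative_eq_intros\<close>)
  from DERIV_cmult[OF this, of p]
  show "((\<lambda>s. p * error_bound L (s - a)) has_real_derivative p * ((s - a) * exp (L * (s - a)))) (at s)"
    by simp
  have "(s - a) + L * error_bound L (s - a) \<le> (s - a) * exp (L * (s - a))"
  proof -
    have "s - a \<le> (exp (L * (s - a)) - 1) / L"
      using exp_ge_add_one_self[of "L * (s - a)"] L
      by (simp add: pos_le_divide_eq mult.commute[of _ L] del: exp_ge_add_one_self)
    moreover have "L * error_bound L (s - a)
        = (s - a) * exp (L * (s - a)) - (exp (L * (s - a)) - 1) / L"
      using L by (simp add: error_bound_def power2_eq_square field_simps)
    ultimately show ?thesis by linarith
  qed
  then show "p * (s - a) + L * (p * error_bound L (s - a)) \<le> p * ((s - a) * exp (L * (s - a)))"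
    using mult_left_mono[OF _ p] by (fastforce simp: algebra_simps)
qed auto

text \<open>The integral cannot reach \<open>\<delta>\<close> before time \<open>d\<close>, hence the lower bound. If it exceeded \<open>\<delta>\<close> at
  \<open>t1\<close>, it would have crossed \<open>\<delta>\<close> earlier by continuity, and the trigger would have fired then; so it is
  at most \<open>\<delta>\<close> also when the period is ended by the horizon.\<close>

lemma trigger_time_bounds:
  fixes e :: "real \<Rightarrow> real"
  assumes cont: "continuous_on {a..a + T} e" and \<delta>: "0 < \<delta>" and T: "0 \<le> T" and d: "d \<le> T"
    and below: "\<And>h. 0 < h \<Longrightarrow> h < d \<Longrightarrow> integral {a..a + h} e < \<delta>"
    and t1: "ereal t1 = min (ereal a + Inf (ereal ` {h. 0 < h \<and> integral {a..a + h} e = \<delta>}))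
               (ereal (a + T))"
  shows "a + d \<le> t1" "t1 \<le> a + T" "a \<le> t1" "integral {a..t1} e \<le> \<delta>"
proof -
  let ?I = "\<lambda>h. integral {a..a + h} e"
  let ?H = "Inf (ereal ` {h. 0 < h \<and> ?I h = \<delta>})"
  have "ereal t1 \<le> ereal (a + T)" unfolding t1 by simp
  then show t1T: "t1 \<le> a + T" by simp
  have lower: "a + c \<le> t1" if "c \<le> T" "\<And>h. 0 < h \<Longrightarrow> ?I h = \<delta> \<Longrightarrow> c \<le> h" for c
  proof -
    have "ereal c \<le> ?H" using that(2) by (intro Inf_greatest) auto
    then have "ereal a + ereal c \<le> ereal a + ?H" by (rule add_left_mono)
    then have "ereal (a + c) \<le> ereal t1" unfolding t1 using that(1) by simp
    then show ?thesis by simp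
  qed
  show "a + d \<le> t1"
    using below by (intro lower[OF d]) (metis not_le order_less_irrefl)
  show a1: "a \<le> t1" using lower[of 0] T by simp
  show "integral {a..t1} e \<le> \<delta>"
  proof (rule ccontr)
    assume "\<not> ?thesis"
    then have gt: "\<delta> < ?I (t1 - a)" by simp
    have I_cont: "continuous_on {0..t1 - a} ?I"
    proof -
      have "continuous_on {a..t1} e" using cont t1T by (auto elim: continuous_on_subset)
      then have "continuous_on {a..t1} (\<lambda>s. integral {a..s} e)"
        by (intro indefinite_integral_continuous_1 integrable_continuous_interval)
      then show ?thesis by (rule continuous_on_compose2) (auto intro!: continuous_intros)
    qed
    have "?I 0 \<le> \<delta>" using \<delta> by simp
    then obtain h where h: "0 \<le> h" "h \<le> t1 - a" "?I h = \<delta>"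
      using IVT'[of ?I 0 \<delta> "t1 - a"] gt I_cont a1 by auto
    then have "0 < h" "h < t1 - a" using \<delta> gt by (auto simp: order_less_le)
    then have "?H \<le> ereal h" using h by (intro Inf_lower) auto
    then have "ereal a + ?H \<le> ereal a + ereal h" by (rule add_left_mono)
    moreover have "ereal t1 \<le> ereal a + ?H" unfolding t1 by simp
    ultimately have "ereal t1 \<le> ereal a + ereal h" by (rule order_trans[rotated])
    then have "t1 \<le> a + h" by simp
    then show False using \<open>h < t1 - a\<close> by simp
  qed
qed

text \<open>Delaying the trigger from \<open>b\<close> to \<open>h\<close> adds \<open>p (h - b)\<close> to the error and saves the factor
  \<open>exp (L (h - b))\<close> in its later growth; the saving wins because \<open>L b > 1\<close>. So \<open>h = b\<close> is the worst case,
  and there the claim amounts to \<open>p b (L b - 1) \<le> L \<delta>\<close>, which follows from \<open>L b \<le> exp (L b)\<close>.\<close>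

lemma deviation_at_trigger_le:
  fixes L T \<beta> p h :: real
  assumes L: "0 < L" and p: "0 \<le> p" and b: "1 < L * b" "b \<le> h"
  defines "\<delta> \<equiv> p * error_bound L b"
  shows "(L * \<delta> + p * h) * exp (L * (T - h))
    \<le> L\<^sup>2 * b * exp (L * (T - b)) / (L * b - 1) * \<delta>"
proof -
  have b0: "0 < b" using b(1) L by (metis less_trans zero_less_mult_pos zero_less_one)
  have \<delta>: "0 \<le> \<delta>"
    using p error_bound_strict_mono[of L 0 b] L b0 by (simp add: \<delta>_def)
  have "L * \<delta> + p * h \<le> (L * \<delta> + p * b) * exp (L * (h - b))"
  proof -
    have "p * (h - b) * 1 \<le> p * (h - b) * (L * b)"
      using p b by (intro mult_left_mono) auto
    then have "p * (h - b) \<le> p * b * (L * (h - b))" by (simp add: mult_ac)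
    also have "\<dots> \<le> (L * \<delta> + p * b) * (L * (h - b))"
      using L \<delta> b by (intro mult_right_mono) auto
    finally have "L * \<delta> + p * h \<le> (L * \<delta> + p * b) * (1 + L * (h - b))"
      by (simp add: algebra_simps)
    also have "\<dots> \<le> (L * \<delta> + p * b) * exp (L * (h - b))"
      using L \<delta> p b0 by (intro mult_left_mono exp_ge_add_one_self) auto
    finally show ?thesis .
  qed
  then have "(L * \<delta> + p * h) * exp (L * (T - h))
      \<le> (L * \<delta> + p * b) * exp (L * (h - b)) * exp (L * (T - h))"
    by (rule mult_right_mono) simp
  also have "\<dots> = (L * \<delta> + p * b) * exp (L * (T - b))"
    by (simp add: mult.assoc exp_add[symmetric] algebra_simps)
  also have "L * \<delta> + p * b \<le> L\<^sup>2 * b / (L * b - 1) * \<delta>"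
  proof -
    have "p * b * (L * b - 1) \<le> L * \<delta>"
    proof -
      have "1 \<le> exp (L * b)" using b(1) by simp
      moreover have "L * b \<le> exp (L * b)" using exp_ge_add_one_self[of "L * b"] by linarith
      ultimately have "L * b * (L * b - 1) \<le> exp (L * b) * (L * b - 1) + 1"
        using mult_right_mono[of "L * b" "exp (L * b)" "L * b - 1"] b(1) by linarith
      then have "p * (L * b * (L * b - 1)) \<le> p * (exp (L * b) * (L * b - 1) + 1)"
        using p by (rule mult_left_mono)
      also have "\<dots> = L\<^sup>2 * \<delta>"
        using L by (simp add: \<delta>_def error_bound_def field_simps power2_eq_square)
      finally have "L * (p * b * (L * b - 1)) \<le> L * (L * \<delta>)"
        by (simp add: power2_eq_square mult_ac)
      then show ?thesis using L by simp
    qed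
    then have "(L * \<delta> + p * b) * (L * b - 1) \<le> L\<^sup>2 * b * \<delta>"
      by (simp add: algebra_simps power2_eq_square)
    then show ?thesis using b(1) by (simp add: pos_le_divide_eq)
  qed
  finally show ?thesis by (simp add: mult_ac)
qed


section \<open>The candidate control and recursive feasibility\<close>

text \<open>An exponential that lies below an affine function at \<open>0\<close> and at \<open>h\<close> lies below it in between, by
  convexity.\<close>

lemma exp_le_line:
  fixes \<mu> h \<alpha> A r :: real
  assumes h: "0 < h" and r: "0 \<le> r" "r \<le> h" and A: "1 \<le> A" and end_le: "exp (- \<mu> * h) \<le> \<alpha>"
  shows "exp (- \<mu> * r) \<le> (1 - r / h) * A + r / h * \<alpha>"
proof -
  have "exp (- \<mu> * r) = exp ((1 - r / h) *\<^sub>R 0 + (r / h) *\<^sub>R (- \<mu> * h))"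
    using h by simp
  also have "\<dots> \<le> (1 - r / h) * exp 0 + r / h * exp (- \<mu> * h)"
    using h r by (intro convex_onD[OF exp_convex]) auto
  also have "\<dots> \<le> (1 - r / h) * A + r / h * \<alpha>"
    using h r A end_le by (intro add_mono mult_left_mono) auto
  finally show ?thesis .
qed

text \<open>The candidate follows the old control up to \<open>a + T\<close> and the terminal feedback after it. On the first
  part its distance to the old prediction is at most \<open>(1 - \<alpha>) \<epsilon>\<close>, which is also at most the amount by
  which the robustness bound rises when the sampling instant moves by \<open>h\<close>. In particular the candidate is in
  \<open>sublevel P \<epsilon>\<close> at \<open>a + T\<close>, where the old prediction satisfied the terminal constraint with \<open>\<alpha> \<epsilon>\<close>. On
  the second part the bound is affine and the candidate decays exponentially.\<close>

lemma mpc_candidate_feasible: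
  fixes f :: "real^'n \<Rightarrow> real^'m \<Rightarrow> real^'n" and K :: "real^'n^'m"
  assumes P: "pos_def P" and L: "0 < L" and T: "0 < T" and \<epsilon>: "0 < \<epsilon>" and \<alpha>: "0 < \<alpha>"
    and U: "compact U" and f_cont: "continuous_on UNIV (\<lambda>(y, v). f y v)"
    and f_lipschitz: "\<And>y z v. v \<in> U \<Longrightarrow> wnorm P (f y v - f z v) \<le> L * wnorm P (y - z)"
    and feasible: "mpc_feasible f U P T \<alpha> \<epsilon> M a xk u xh"
    and h: "0 < h" "h \<le> T"
    and deviation: "wnorm P (x1 - xh (a + h)) * exp (L * (T - h)) \<le> (1 - \<alpha>) * \<epsilon>"
    and contraction: "(1 - \<alpha>) * \<epsilon> \<le> h / T * (M - 1) * (\<alpha> * \<epsilon>)"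
    and terminal_input: "\<And>y. y \<in> sublevel P \<epsilon> \<Longrightarrow> K *v y \<in> U"
    and terminal: "\<And>y0. y0 \<in> sublevel P \<epsilon> \<Longrightarrow>
      \<exists>y. y (a + T) = y0 \<and> solves_ode (\<lambda>_ z. f z (K *v z)) y (a + T) (a + T + h) \<and>
        (\<forall>s\<in>{a + T..a + T + h}. wnorm P (y s) \<le> \<epsilon> * exp (- \<mu> * (s - (a + T))))"
    and \<mu>: "0 \<le> \<mu>" "exp (- \<mu> * h) \<le> \<alpha>"
  shows "\<exists>u' x'. mpc_feasible f U P T \<alpha> \<epsilon> M (a + h) x1 u' x'"
proof -
  define c where "c = a + T"
  define b where "b = a + h"
  have bc: "a < b" "b \<le> c" "c < b + T" and bT: "b + T = a + T + h"
    using h T by (auto simp: b_def c_def)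
  define g where "g s = ((c - s) * M + s - a) / T * (\<alpha> * \<epsilon>)" for s
  have u: "piecewise_right_continuous a c u" and xh: "solves_ode (\<lambda>s y. f y (u s)) xh a c"
    and u_U: "\<And>s. s \<in> {a..c} \<Longrightarrow> u s \<in> U"
    and xh_le: "\<And>s. s \<in> {a..c} \<Longrightarrow> wnorm P (xh s) \<le> g s"
    using feasible by (auto simp: mpc_feasible_def c_def g_def)
  define S where "S x = matrix_sqrt P *v x" for x
  have S: "bounded_linear S" unfolding S_def by (rule matrix_vector_mul_bounded_linear)
  have wS: "wnorm P x = norm (S x)" for x by (simp add: S_def wnorm_eq_norm_sqrt[OF P])

  let ?F = "\<lambda>s y. f y (u s)"
  obtain x where x: "x b = x1" "solves_ode ?F x b c"
  proof -
    define l where "l = L * lambda_max (matrix_sqrt P) / sqrt (lambda_min P)"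
    have pos: "0 < lambda_max (matrix_sqrt P)" "0 < sqrt (lambda_min P)"
      using pos_def_lambda_pos[OF P] pos_def_lambda_pos[OF matrix_sqrt_pos_def(1)[OF P]] by auto
    have "norm (?F s y - ?F s z) \<le> l * norm (y - z)" if "s \<in> {b..c}" for s y z
    proof -
      have "sqrt (lambda_min P) * norm (?F s y - ?F s z) \<le> wnorm P (?F s y - ?F s z)"
        by (rule norm_le_wnorm[OF P])
      also have "\<dots> \<le> L * wnorm P (y - z)" using that bc by (intro f_lipschitz u_U) auto
      also have "\<dots> \<le> L * (lambda_max (matrix_sqrt P) * norm (y - z))"
        using L wnorm_le_norm[OF P] by (intro mult_left_mono) auto
      finally show ?thesis using pos by (simp add: l_def field_simps)
    qed
    moreover have "(\<lambda>s. f (y s) (u s)) integrable_on {b..c}" if "continuous_on {b..c} y" for y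
      using u_U bc
      by (intro integrable_controlled_vector_field[OF f_cont U _ _ that]
          piecewise_right_continuous_tail[OF u]) auto
    moreover have "0 < l" using L pos by (simp add: l_def)
    ultimately show ?thesis
      using solves_ode_exists[OF bc(2), of l ?F x1] that by blast
  qed

  have xh_b: "solves_ode ?F xh b c" using solves_ode_subinterval[OF xh, of b c] bc by simp
  have x_le: "wnorm P (x s) \<le> g s + (1 - \<alpha>) * \<epsilon>" if s: "s \<in> {b..c}" for s
  proof -
    have "norm (S (x r - xh r)) \<le> wnorm P (x1 - xh b) + L * integral {b..r} (\<lambda>q. norm (S (x q - xh q)))"
      if r: "r \<in> {b..c}" for r
    proof -
      have "norm (S (?F q (x q) - ?F q (xh q))) \<le> L * norm (S (x q - xh q)) + 0"
        if "q \<in> {b..c}" for q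
        using f_lipschitz[OF u_U[of q]] that bc by (simp add: wS)
      from solves_ode_difference_bound[OF S x(2) xh_b this r] show ?thesis
        by (simp add: wS x(1))
    qed
    moreover have "continuous_on {b..c} (\<lambda>s. norm (S (x s - xh s)))"
      by (intro continuous_intros bounded_linear.continuous_on[OF S] solves_ode_continuous[OF x(2)]
          solves_ode_continuous[OF xh_b])
    ultimately have "wnorm P (x s - xh s) \<le> wnorm P (x1 - xh b) * exp (L * (s - b))"
      unfolding wS using gronwall_inequality[OF _ L _ s, where \<phi> = "\<lambda>s. norm (S (x s - xh s))"] by blast
    also have "\<dots> \<le> wnorm P (x1 - xh b) * exp (L * (T - h))"
      using s L wnorm_nonneg[OF P] by (intro mult_left_mono) (auto simp: b_def c_def)
    also have "\<dots> \<le> (1 - \<alpha>) * \<epsilon>" using deviation by (simp add: b_def)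
    finally show ?thesis
      using xh_le[of s] wnorm_triangle[OF P, of "x s - xh s" "xh s"] s bc by simp
  qed
  have "g c = \<alpha> * \<epsilon>" using T by (simp add: g_def c_def)
  then have "x c \<in> sublevel P \<epsilon>"
    using x_le[of c] bc by (simp add: sublevel_def algebra_simps)
  then obtain y where y: "y c = x c" "solves_ode (\<lambda>_ z. f z (K *v z)) y c (b + T)"
    and y_le: "\<And>s. s \<in> {c..b + T} \<Longrightarrow> wnorm P (y s) \<le> \<epsilon> * exp (- \<mu> * (s - c))"
    using terminal[of "x c"] unfolding bT c_def[symmetric] by blast
  have y_in: "y s \<in> sublevel P \<epsilon>" if "s \<in> {c..b + T}" for s
  proof -
    have "exp (- \<mu> * (s - c)) \<le> 1" using that \<mu>(1) by simp
    then have "\<epsilon> * exp (- \<mu> * (s - c)) \<le> \<epsilon> * 1" using \<epsilon> by (intro mult_left_mono) auto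
    then show ?thesis using y_le[OF that] by (simp add: sublevel_def)
  qed

  define x' where "x' s = (if s < c then x s else y s)" for s
  define u' where "u' s = (if s < c then u s else K *v y s)" for s
  let ?F' = "\<lambda>s y. f y (u' s)"
  have x'_x: "x' s = x s" if "s \<in> {b..c}" for s using that y(1) by (auto simp: x'_def)
  have x'_y: "x' s = y s" if "s \<in> {c..b + T}" for s using that by (auto simp: x'_def)
  have "solves_ode ?F' x' b c"
    by (rule solves_ode_cong_finite[OF x(2), of "{c}"]) (auto simp: x'_x u'_def)
  moreover have "solves_ode ?F' x' c (b + T)"
    by (rule solves_ode_cong_finite[OF y(2) finite.emptyI]) (auto simp: x'_y u'_def)
  ultimately have ode: "solves_ode ?F' x' b (b + T)"
    by (rule solves_ode_combine) (use bc in auto)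
  have u'_cont: "piecewise_right_continuous b (b + T) u'"
    unfolding u'_def[abs_def] using bc
    by (intro piecewise_right_continuous_append piecewise_right_continuous_tail[OF u]
        bounded_linear.continuous_on[OF matrix_vector_mul_bounded_linear]
        solves_ode_continuous[OF y(2)]) auto
  have u'_U: "u' s \<in> U" if "s \<in> {b..b + T}" for s
    using that u_U[of s] terminal_input[OF y_in[of s]] bc by (auto simp: u'_def)

  define B where "B s = ((b + T - s) * M + s - b) / T * (\<alpha> * \<epsilon>)" for s
  have "wnorm P (x' s) \<le> B s" if s: "s \<in> {b..b + T}" for s
  proof (cases "s \<le> c")
    case True
    have "B s = g s + h / T * (M - 1) * (\<alpha> * \<epsilon>)"
      using T by (simp add: B_def g_def b_def c_def field_simps)
    then show ?thesis using x_le[of s] contraction True s x'_x[of s] by simp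
  next
    case False
    define r where "r = s - c"
    have r: "0 \<le> r" "r \<le> h" using False s by (auto simp: r_def b_def c_def)
    \<comment> \<open>In units of \<open>\<epsilon>\<close>, the robustness bound falls linearly from \<open>A\<close> at \<open>r = 0\<close> to \<open>\<alpha>\<close> at \<open>r = h\<close>.\<close>
    define A where "A = \<alpha> * (1 + h / T * (M - 1))"
    have A: "1 \<le> A"
    proof -
      have "1 * \<epsilon> \<le> A * \<epsilon>" using contraction by (simp add: A_def algebra_simps)
      then show ?thesis using \<epsilon> by simp
    qed
    have "wnorm P (x' s) \<le> \<epsilon> * exp (- \<mu> * r)"
      using y_le[of s] x'_y[of s] False s by (simp add: r_def)
    also have "\<dots> \<le> \<epsilon> * ((1 - r / h) * A + r / h * \<alpha>)"
      using exp_le_line[OF h(1) r A \<mu>(2)] \<epsilon> by (intro mult_left_mono) auto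
    also have "\<dots> = B s"
    proof -
      have "s = a + T + r" by (simp add: r_def c_def)
      then show ?thesis using T h by (simp add: A_def B_def b_def field_simps)
    qed
    finally show ?thesis .
  qed
  moreover have "x' b = x1" using x'_x[of b] x(1) bc by simp
  ultimately have "mpc_feasible f U P T \<alpha> \<epsilon> M b x1 u' x'"
    using ode u'_cont u'_U unfolding mpc_feasible_def B_def by blast
  then show ?thesis unfolding b_def by blast
qed

theorem theorem2:
  fixes f :: "real^'n \<Rightarrow> real^'m \<Rightarrow> real^'n"
    and U :: "(real^'m) set" and W :: "(real^'n) set"
    and A :: "real^'n^'n" and B :: "real^'m^'n" and K :: "real^'n^'m"
    and Q Qs P :: "real^'n^'n" and R :: "real^'m^'m"
    and \<rho> L \<kappa> \<epsilon> T \<alpha> \<beta> M \<delta> :: real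
    and w x :: "real \<Rightarrow> real^'n"
    and t :: "nat \<Rightarrow> real"
    and u :: "nat \<Rightarrow> real \<Rightarrow> real^'m"
    and xh xa :: "nat \<Rightarrow> real \<Rightarrow> real^'n"
  assumes U: "compact U" "0 \<in> U"
    and W: "compact W" "\<rho> = (SUP v\<in>W. norm v)"
    and f_smooth: "twice_continuously_differentiable (\<lambda>(y, v). f y v)"
    and f_zero: "f 0 0 = 0"
    and L: "L > 0"
    and f_lipschitz: "\<And>y z v. v \<in> U \<Longrightarrow> wnorm P (f y v - f z v) \<le> L * wnorm P (y - z)"
    and A_def: "A = jacobian (\<lambda>y. f y 0) (at 0)"
    and B_def: "B = jacobian (\<lambda>v. f 0 v) (at 0)"
    and weights: "pos_def Q" "pos_def R"
    and stable: "spectral_abscissa (A + B ** K) < 0"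
    and Qs_def: "Qs = Q + transpose K ** R ** K"
    and \<kappa>: "\<kappa> > 0" "\<kappa> < - spectral_abscissa (A + B ** K)"
    and P: "pos_def P"
      "transpose (A + B ** K + mat \<kappa>) ** P + P ** (A + B ** K + mat \<kappa>) = - Qs"
    and \<epsilon>: "\<epsilon> > 0"
    and terminal_invariant: "forward_invariant (\<lambda>y. f y (K *v y)) (sublevel P \<epsilon>)"
    and terminal_input: "\<And>y. y \<in> sublevel P \<epsilon> \<Longrightarrow> K *v y \<in> U"
    and terminal_decrease: "\<And>y. y \<in> sublevel P \<epsilon> \<Longrightarrow>
      frechet_derivative (\<lambda>z. (wnorm P z)\<^sup>2) (at y) (f y (K *v y)) \<le> - (wnorm Qs y)\<^sup>2"
    and T: "T > 0"
    and \<alpha>: "0 < \<alpha>" "\<alpha> < 1"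
    and \<beta>: "0 < \<beta>" "\<beta> < 1"
    and \<delta>: "\<delta> > 0"
      "\<delta> = \<rho> * lambda_max (matrix_sqrt P) *
             (exp (L * \<beta> * T) * (\<beta> * T / L - 1 / L\<^sup>2) + 1 / L\<^sup>2)"
    and LT: "L * \<beta> * T \<noteq> 1"
    and disturbance: "\<And>s. s \<ge> t 0 \<Longrightarrow> w s \<in> W"
    and initially_feasible: "\<exists>u0 x0. mpc_feasible f U P T \<alpha> \<epsilon> M (t 0) (x (t 0)) u0 x0"
    and cond_disturbance:
      "L\<^sup>2 * \<beta> * T * exp (L * (1 - \<beta>) * T) / (L * \<beta> * T - 1) *
         (\<rho> * lambda_max (matrix_sqrt P) *
            (exp (L * \<beta> * T) * (\<beta> * T / L - 1 / L\<^sup>2) + 1 / L\<^sup>2))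
       \<le> (1 - \<alpha>) * \<epsilon>"
    and cond_horizon:
      "T \<ge> max (- 2 * (lambda_max P / (lambda_min Qs * \<beta>)) * ln \<alpha>) (1 / (L * \<beta>))"
    and cond_contraction:
      "M \<ge> max (L\<^sup>2 * \<beta> * T * exp (L * (1 - \<beta>) * T) / (L * \<beta> * T - 1) * (\<delta> / (\<alpha> * \<epsilon>)) + 1)
               (1 - 1 / \<beta> + 1 / (\<alpha> * \<beta>))"
  shows
    "(\<forall>k\<ge>1. (\<forall>j<k. closed_loop_step f U Q R P T \<alpha> \<epsilon> M \<delta> w x
                        (t j) (t (Suc j)) (u j) (xh j) (xa j)) \<longrightarrow>
          (\<exists>u' x'. mpc_feasible f U P T \<alpha> \<epsilon> M (t k) (x (t k)) u' x'))
     \<and>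
     \<rho> \<le> (1 - \<alpha>) * \<epsilon> /
         (L\<^sup>2 * \<beta> * T * exp (L * (1 - \<beta>) * T) / (L * \<beta> * T - 1) *
            lambda_max (matrix_sqrt P) *
            (exp (L * \<beta> * T) * (\<beta> * T / L - 1 / L\<^sup>2) + 1 / L\<^sup>2))
     \<and>
     (\<forall>r\<ge>0.
         L\<^sup>2 * \<beta> * T * exp (L * (1 - \<beta>) * T) / (L * \<beta> * T - 1) *
            (r * lambda_max (matrix_sqrt P) *
               (exp (L * \<beta> * T) * (\<beta> * T / L - 1 / L\<^sup>2) + 1 / L\<^sup>2))
          \<le> (1 - \<alpha>) * \<epsilon> \<longleftrightarrow>
         r \<le> (1 - \<alpha>) * \<epsilon> /
           (L\<^sup>2 * \<beta> * T * exp (L * (1 - \<beta>) * T) / (L * \<beta> * T - 1) *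
              lambda_max (matrix_sqrt P) *
              (exp (L * \<beta> * T) * (\<beta> * T / L - 1 / L\<^sup>2) + 1 / L\<^sup>2)))"
proof -
  define b where "b = \<beta> * T"
  define lam where "lam = lambda_max (matrix_sqrt P)"
  define p where "p = \<rho> * lam"
  \<comment> \<open>With these abbreviations the disturbance condition reads \<open>c * \<delta> \<le> (1 - \<alpha>) * \<epsilon>\<close>.\<close>
  define c where "c = L\<^sup>2 * b * exp (L * (T - b)) / (L * b - 1)"
  have c_eq: "L\<^sup>2 * \<beta> * T * exp (L * (1 - \<beta>) * T) / (L * \<beta> * T - 1) = c"
    by (simp add: c_def b_def algebra_simps)
  have eb_eq: "exp (L * \<beta> * T) * (\<beta> * T / L - 1 / L\<^sup>2) + 1 / L\<^sup>2 = error_bound L b"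
    by (simp add: error_bound_def b_def mult.assoc)
  have b: "0 < b" "b < T" using T \<beta> by (simp_all add: b_def)
  have Lb: "1 < L * b"
  proof -
    have "1 / (L * \<beta>) \<le> T" using cond_horizon by simp
    then have "1 \<le> L * b" using L \<beta> by (simp add: b_def field_simps)
    then show ?thesis using LT by (simp add: b_def mult.assoc)
  qed
  have lam: "0 < lam"
    unfolding lam_def by (rule pos_def_lambda_pos(2)[OF matrix_sqrt_pos_def(1)[OF P(1)]])
  have eb: "0 < error_bound L b" using error_bound_strict_mono[of L 0 b] L b by simp
  have c: "0 < c" using L b Lb by (simp add: c_def)
  have \<delta>_eq: "\<delta> = p * error_bound L b" using \<delta>(2) unfolding eb_eq by (simp add: p_def lam_def)
  have p: "0 < p" using \<delta>(1) eb unfolding \<delta>_eq by (simp add: zero_less_mult_iff)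

  have Qs: "pos_def Qs"
    unfolding Qs_def by (rule pos_def_plus_congruence[OF weights])
  define \<mu> where "\<mu> = lambda_min Qs / lambda_max P / 2"
  have \<mu>: "0 < \<mu>"
    using pos_def_lambda_pos(1)[OF Qs] pos_def_lambda_pos(2)[OF P(1)] by (simp add: \<mu>_def)
  have \<mu>_b: "exp (- \<mu> * h) \<le> \<alpha>" if "b \<le> h" for h
  proof -
    have "- 2 * (lambda_max P / (lambda_min Qs * \<beta>)) * ln \<alpha> \<le> T" using cond_horizon by simp
    then have "- ln \<alpha> \<le> \<mu> * b"
      using pos_def_lambda_pos(1)[OF Qs] pos_def_lambda_pos(2)[OF P(1)] \<beta>(1)
      by (simp add: \<mu>_def b_def field_simps)
    also have "\<dots> \<le> \<mu> * h" using \<mu> that by simp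
    finally have "exp (- \<mu> * h) \<le> exp (ln \<alpha>)" by simp
    then show ?thesis using \<alpha>(1) by simp
  qed
  have f_cont: "continuous_on UNIV (\<lambda>(y, v). f y v)"
    by (rule twice_continuously_differentiable_continuous[OF f_smooth])
  obtain C where C: "C-lipschitz_on (sublevel P \<epsilon>) (\<lambda>y. f y (K *v y))"
    using lipschitz_closed_loop_field[OF f_smooth compact_sublevel[OF P(1)] convex_sublevel[OF P(1)]]
    by blast
  have decrease: "2 * (y \<bullet> (P *v f y (K *v y))) \<le> - (wnorm Qs y)\<^sup>2" if "y \<in> sublevel P \<epsilon>" for y
    using terminal_decrease[OF that]
    unfolding frechet_derivative_at[OF has_derivative_wnorm_power2[OF P(1), of y], symmetric] .
  have terminal: "\<exists>y. y d = y0 \<and> solves_ode (\<lambda>_ z. f z (K *v z)) y d (d + h) \<and>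
      (\<forall>s\<in>{d..d + h}. wnorm P (y s) \<le> \<epsilon> * exp (- \<mu> * (s - d)))"
    if "y0 \<in> sublevel P \<epsilon>" "0 \<le> h" for y0 d h
    unfolding \<mu>_def using that(2)
    by (intro terminal_trajectory[OF P(1) Qs \<epsilon> _ C decrease that(1)]) auto
  have M: "(1 - \<alpha>) * \<epsilon> \<le> h / T * (M - 1) * (\<alpha> * \<epsilon>)" if "b \<le> h" for h
  proof -
    have "1 - 1 / \<beta> + 1 / (\<alpha> * \<beta>) \<le> M" using cond_contraction by simp
    then have *: "(1 - \<alpha>) / (\<alpha> * \<beta>) \<le> M - 1"
      using \<alpha>(1) \<beta>(1) by (simp add: field_simps)
    then have "1 - \<alpha> \<le> \<beta> * (M - 1) * \<alpha>"
      using \<alpha>(1) \<beta>(1) by (simp add: field_simps)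
    also have "\<dots> \<le> h / T * (M - 1) * \<alpha>"
    proof -
      have "0 \<le> (1 - \<alpha>) / (\<alpha> * \<beta>)" using \<alpha> \<beta> by simp
      moreover have "\<beta> \<le> h / T" using that T by (simp add: b_def field_simps)
      ultimately show ?thesis using * \<alpha>(1) by (intro mult_right_mono) auto
    qed
    finally have "(1 - \<alpha>) * \<epsilon> \<le> h / T * (M - 1) * \<alpha> * \<epsilon>"
      using mult_right_mono[OF _ less_imp_le[OF \<epsilon>]] by blast
    then show ?thesis by (simp only: mult.assoc)
  qed

  define S where "S x = matrix_sqrt P *v x" for x
  have S: "bounded_linear S" unfolding S_def by (rule matrix_vector_mul_bounded_linear)
  have wS: "wnorm P x = norm (S x)" for x by (simp add: S_def wnorm_eq_norm_sqrt[OF P(1)])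

  have step: "t j \<le> t (Suc j)"
    "\<exists>u' x'. mpc_feasible f U P T \<alpha> \<epsilon> M (t (Suc j)) (x (t (Suc j))) u' x'"
    if t0: "t 0 \<le> t j" and loop: "closed_loop_step f U Q R P T \<alpha> \<epsilon> M \<delta> w x
                        (t j) (t (Suc j)) (u j) (xh j) (xa j)" for j
  proof -
    let ?a = "t j" and ?t1 = "t (Suc j)"
    let ?e = "\<lambda>s. wnorm P (xa j s - xh j s)"
    let ?F = "\<lambda>s y. f y (u j s)" and ?Fw = "\<lambda>s y. f y (u j s) + w s"
    have feasible: "mpc_feasible f U P T \<alpha> \<epsilon> M ?a (x ?a) (u j) (xh j)"
      using loop by (simp add: closed_loop_step_def mpc_optimal_def)
    have xh: "solves_ode ?F (xh j) ?a (?a + T)" "xh j ?a = x ?a"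
      and u_U: "\<And>s. s \<in> {?a..?a + T} \<Longrightarrow> u j s \<in> U"
      using feasible by (auto simp: mpc_feasible_def)
    have xa: "solves_ode ?Fw (xa j) ?a (?a + T)" "xa j ?a = x ?a"
      and x: "solves_ode ?Fw x ?a ?t1"
      and t1: "ereal ?t1 = min (ereal ?a + trigger_interval P \<delta> ?a (xa j) (xh j)) (ereal (?a + T))"
      using loop by (auto simp: closed_loop_step_def)
    have e_cont: "continuous_on {?a..?a + T} ?e"
      by (intro continuous_intros P solves_ode_continuous[OF xa(1)] solves_ode_continuous[OF xh(1)])
    have w_le: "wnorm P (w s) \<le> p" if "s \<ge> t 0" for s
    proof -
      have "bdd_above (norm ` W)"
        using compact_imp_bounded[OF W(1)] by (auto simp: bounded_iff bdd_above_def)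
      then have "norm (w s) \<le> \<rho>" unfolding W(2) by (rule cSUP_upper[OF disturbance[OF that]])
      then have "lam * norm (w s) \<le> p" using lam by (simp add: p_def mult.commute)
      then show ?thesis using wnorm_le_norm[OF P(1), of "w s"] by (simp add: lam_def)
    qed
    have e_le: "?e s \<le> p * (s - ?a) + L * integral {?a..s} ?e" if s: "s \<in> {?a..?a + T}" for s
    proof -
      have "norm (S (?Fw r (xa j r) - ?F r (xh j r))) \<le> L * norm (S (xa j r - xh j r)) + p"
        if r: "r \<in> {?a..?a + T}" for r
      proof -
        have "wnorm P (?Fw r (xa j r) - ?F r (xh j r))
            \<le> wnorm P (?F r (xa j r) - ?F r (xh j r)) + wnorm P (w r)"
          using wnorm_triangle[OF P(1), of "?F r (xa j r) - ?F r (xh j r)" "w r"]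
          by (simp add: algebra_simps)
        also have "\<dots> \<le> L * wnorm P (xa j r - xh j r) + p"
          using r t0 by (intro add_mono f_lipschitz u_U w_le) auto
        finally show ?thesis by (simp add: wS)
      qed
      from solves_ode_difference_bound[OF S xa(1) xh(1) this s] show ?thesis
        by (simp add: wS xa(2) xh(2) linear_0[OF bounded_linear.linear[OF S]])
    qed
    have below: "integral {?a..?a + h} ?e < \<delta>" if "0 < h" "h < b" for h
    proof -
      have "integral {?a..?a + h} ?e \<le> p * error_bound L (?a + h - ?a)"
        using that b p by (intro integrated_error_le[OF e_cont L _ e_le]) auto
      also have "\<dots> < \<delta>"
        unfolding \<delta>_eq using that p L by (intro mult_strict_left_mono) (auto intro: error_bound_strict_mono)
      finally show ?thesis .
    qed
    note trigger = trigger_time_bounds[OF e_cont \<delta>(1) less_imp_le[OF T] less_imp_le[OF b(2)] below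
        t1[unfolded trigger_interval_def]]
    show "?a \<le> ?t1" by (rule trigger(3))
    define h where "h = ?t1 - ?a"
    have h: "b \<le> h" "h \<le> T" "0 < h" "?a + h = ?t1" using trigger(1,2) b by (auto simp: h_def)
    \<comment> \<open>The closed-loop state and \<open>xa j\<close> solve the same initial value problem, so they agree up to \<open>?t1\<close>.\<close>
    have x_eq: "x ?t1 = xa j ?t1"
    proof -
      have xa': "solves_ode ?Fw (xa j) ?a ?t1"
        using solves_ode_subinterval[OF xa(1), of ?a ?t1] trigger(2) by simp
      have le: "norm (S (?Fw r (x r) - ?Fw r (xa j r))) \<le> L * norm (S (x r - xa j r)) + 0"
        if "r \<in> {?a..?t1}" for r
        using f_lipschitz[OF u_U[of r]] that trigger(2) by (simp add: wS)
      have "norm (S (x r - xa j r)) \<le> 0 + L * integral {?a..r} (\<lambda>s. norm (S (x s - xa j s)))"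
        if "r \<in> {?a..?t1}" for r
        using solves_ode_difference_bound[OF S x xa' le that]
        by (simp add: xa(2) linear_0[OF bounded_linear.linear[OF S]])
      moreover have "continuous_on {?a..?t1} (\<lambda>s. norm (S (x s - xa j s)))"
        by (intro continuous_intros bounded_linear.continuous_on[OF S] solves_ode_continuous[OF x]
            solves_ode_continuous[OF xa'])
      ultimately have "norm (S (x ?t1 - xa j ?t1)) \<le> 0 * exp (L * (?t1 - ?a))"
        using gronwall_inequality[OF _ L, of ?a ?t1 "\<lambda>s. norm (S (x s - xa j s))" 0 ?t1] trigger(3)
        by simp
      then have "sqrt (lambda_min P) * norm (x ?t1 - xa j ?t1) \<le> 0"
        using norm_le_wnorm[OF P(1), of "x ?t1 - xa j ?t1"] by (simp add: wS)
      then show ?thesis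
        using pos_def_lambda_pos(1)[OF P(1)] by (simp add: mult_le_0_iff)
    qed
    have "?e ?t1 \<le> p * h + L * integral {?a..?t1} ?e"
      using e_le[of ?t1] trigger(2,3) by (simp add: h_def)
    also have "\<dots> \<le> p * h + L * \<delta>" using trigger(4) L by simp
    finally have "?e ?t1 * exp (L * (T - h)) \<le> (L * \<delta> + p * h) * exp (L * (T - h))"
      by (intro mult_right_mono) auto
    also have "\<dots> \<le> c * \<delta>"
      unfolding c_def \<delta>_eq using p by (intro deviation_at_trigger_le[OF L _ Lb h(1)]) simp
    also have "\<dots> \<le> (1 - \<alpha>) * \<epsilon>"
      using cond_disturbance unfolding c_eq eb_eq \<delta>_eq by (simp add: p_def lam_def)
    finally have deviation: "wnorm P (x ?t1 - xh j (?a + h)) * exp (L * (T - h)) \<le> (1 - \<alpha>) * \<epsilon>"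
      by (simp add: x_eq h(4))
    from mpc_candidate_feasible[OF P(1) L T \<epsilon> \<alpha>(1) U(1) f_cont f_lipschitz feasible h(3,2) deviation
        M[OF h(1)] terminal_input terminal less_imp_le[OF \<mu>] \<mu>_b[OF h(1)]]
    show "\<exists>u' x'. mpc_feasible f U P T \<alpha> \<epsilon> M ?t1 (x ?t1) u' x'"
      using h by simp
  qed
  have feasible: "\<exists>u' x'. mpc_feasible f U P T \<alpha> \<epsilon> M (t k) (x (t k)) u' x'"
    if "k \<ge> 1" and loop: "\<forall>j<k. closed_loop_step f U Q R P T \<alpha> \<epsilon> M \<delta> w x
                        (t j) (t (Suc j)) (u j) (xh j) (xa j)" for k
  proof -
    have "t 0 \<le> t j" if "j \<le> k" for j
      using that
    proof (induction j)
      case (Suc j)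
      then show ?case using step(1)[of j] loop by simp
    qed simp
    moreover obtain j where "k = Suc j" using \<open>k \<ge> 1\<close> by (cases k) auto
    ultimately show ?thesis using step(2)[of j] loop by simp
  qed

  have bound_iff: "c * (r * lam * error_bound L b) \<le> (1 - \<alpha>) * \<epsilon> \<longleftrightarrow>
      r \<le> (1 - \<alpha>) * \<epsilon> / (c * lam * error_bound L b)" for r
    using c lam eb by (simp add: pos_le_divide_eq mult_ac)
  moreover have "c * (\<rho> * lam * error_bound L b) \<le> (1 - \<alpha>) * \<epsilon>"
    using cond_disturbance unfolding c_eq eb_eq lam_def .
  ultimately show ?thesis
    unfolding c_eq eb_eq lam_def[symmetric] using feasible by blast
qed

end
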